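(* Let $h>0$, let $(q(t),p(t),\omega(t))$ be a weak solution of the Hamiltonian system with $\omega(0)\in\Omega$ (so that $\omega(t)\in\Omega$ for all $t$), and set, for $x\in\mathbb R^3$, $t\in\mathbb R$, $m=1,2,3$, $\lambda=1,\dots,N$, $$B_m^{appr}(x,t)=B_m(x,q(t),p(t)),\quad E_m^{appr}(x,t)=E_m(x,q(t),p(t)),\quad S_m^{[\lambda,appr]}(t)=\langle\omega(t),i\sigma_m^{[\lambda]}\rangle,$$ and let $\mathbf B^{appr},\mathbf E^{appr},\mathbf S^{[\lambda,appr]}$ be the corresponding $\mathbb R^3$-valued functions. Then $$\mathrm{div}\,\mathbf B^{appr}(x,t)=\mathrm{div}\,\mathbf E^{appr}(x,t)=0,\qquad \frac{\partial}{\partial t}\mathbf B^{appr}(x,t)=-\mathrm{rot}\,\mathbf E^{appr}(x,t),$$ $$\frac{\partial}{\partial t}\mathbf E^{appr}(x,t)=\mathrm{rot}\,\mathbf B^{appr}(x,t)-h\sum_{\lambda=1}^N\mathbf S^{[\lambda,appr]}(t)\wedge\mathrm{grad}\,\rho(x-x_\lambda),$$ where $$\rho(x)=(2\pi)^{-3}\int_{\mathbb R^3}|\chi(|k|)|^2\cos(k\cdot x)\,dk.$$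
   Context: $H$ is the real Hilbert space of $f=(f_1,f_2,f_3):\mathbb R^3\to\mathbb R^3$ with $f_j\in L^2(\mathbb R^3)$ real valued and $k\cdot f(k)=0$ a.e., with $|f|^2=\sum_j\int|f_j(k)|^2dk$ and scalar product $\cdot$. $M$ is multiplication by $|k|$ in $H$. $\chi\in\mathcal S(\mathbb R)$ is a fixed real-valued function vanishing near $0$; $(e_1,e_2,e_3)$ is the canonical basis of $\mathbb R^3$; $\wedge$ is the cross product; $\mathrm{rot}$ is the curl. For $x\in\mathbb R^3$, $m=1,2,3$, $$a_m(x)(k)=\frac{\chi(|k|)|k|^{1/2}}{(2\pi)^{3/2}}\sin(k\cdot x)\frac{k\wedge e_m}{|k|},\qquad b_m(x)(k)=\frac{\chi(|k|)|k|^{1/2}}{(2\pi)^{3/2}}\cos(k\cdot x)\frac{k\wedge e_m}{|k|},$$ $B_m(x,q,p)=a_m(x)\cdot q+b_m(x)\cdot p$, and $E_m(x,q,p)=-B_m(x,J(q,p))$ for $(q,p)\in H^2$, where $J(q,p)(k)=\big(\frac{k\wedge q(k)}{|k|},\frac{k\wedge p(k)}{|k|}\big)$. Points $x_1,\dots,x_N\in\mathbb R^3$ and $\beta=(\beta_1,\beta_2,\beta_3)\in\mathbb R^3$ are fixed. $\mathcal H_{sp}=(\mathbb C^2)^{\otimes N}$ and $\sigma_m^{[\lambda]}$ is the Pauli matrix $\sigma_m$ acting on the $\lambda$-th factor. $\mathcal G$ is the Lie algebra of $SU(2^N)=SU(\mathcal H_{sp})$ (traceless antihermitian maps), $\mathcal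 G^\star$ its dual; $\Omega\subset\mathcal G^\star$ is the set of forms $\pi_a:Y\mapsto i^{-1}\langle Ya,a\rangle$ with $a$ a unit vector of $\mathcal H_{sp}$. The Hamiltonian system is $q'=Mp+h\sum_{\lambda,m}b_m(x_\lambda)\langle\omega,i\sigma_m^{[\lambda]}\rangle$, $p'=-Mq-h\sum_{\lambda,m}a_m(x_\lambda)\langle\omega,i\sigma_m^{[\lambda]}\rangle$, $\frac{d}{dt}\langle\omega,Y\rangle=\sum_{\lambda,m}(\beta_m+B_m(x_\lambda,q,p))\langle\omega,[i\sigma_m^{[\lambda]},Y]\rangle$ for all $Y\in\mathcal G$. With $R_t(q,p)=(q_t,p_t)$, $q_t(k)=\cos(t|k|)q(k)+\sin(t|k|)p(k)$, $p_t(k)=-\sin(t|k|)q(k)+\cos(t|k|)p(k)$, a weak solution is a continuous map $t\mapsto(X(t),\omega(t))$, $X=(q,p)$, from $\mathbb R$ to $H\times H\times\mathcal G^\star$ satisfying $X(t)=R_t(X(0))+\int_0^tR_{t-s}(Q(s),P(s))ds$, with $Q(s)=h\sum_{\lambda,m}b_m(x_\lambda)\langle\omega(s),i\sigma_m^{[\lambda]}\rangle$, $P(s)=-h\sum_{\lambda,m}a_m(x_\lambda)\langle\omega(s),i\sigma_m^{[\lambda]}\rangle$, and the time-integrated form of the third equation. *)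

theory Defs
  imports "HOL-Analysis.Analysis"
begin

section \<open>The real Hilbert space of square-integrable transversal fields\<close>

text \<open>
  Componentwise square integrability, and \<open>k \<cdot> f(k) = 0\<close> almost everywhere. Every Lebesgue
  class has a Borel representative, so \<open>lborel\<close> gives the usual \<open>L\<^sup>2\<close> space.
\<close>

definition transversal_L2 :: "(real^3 \<Rightarrow> real^3) \<Rightarrow> bool" where
  "transversal_L2 f \<longleftrightarrow>
     (\<forall>j. (\<lambda>k. f k $ j) \<in> borel_measurable lborel \<and> integrable lborel (\<lambda>k. (f k $ j)\<^sup>2)) \<and>
     (AE k in lborel. k \<bullet> f k = 0)"

definition L2_eq :: "(real^3 \<Rightarrow> real^3) \<Rightarrow> (real^3 \<Rightarrow> real^3) \<Rightarrow> bool" where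
  "L2_eq f g \<longleftrightarrow> transversal_L2 f \<and> transversal_L2 g \<and> (AE k in lborel. f k = g k)"

lemma transversal_L2_zero: "transversal_L2 (\<lambda>_. 0)"
  by (simp add: transversal_L2_def)

lemma transversal_L2_integrable_prod:
  assumes "transversal_L2 f" "transversal_L2 g"
  shows "integrable lborel (\<lambda>k. f k $ i * g k $ j)"
proof (rule Bochner_Integration.integrable_bound)
  show "integrable lborel (\<lambda>k. (f k $ i)\<^sup>2 + (g k $ j)\<^sup>2)"
    using assms by (auto simp: transversal_L2_def)
  show "(\<lambda>k. f k $ i * g k $ j) \<in> borel_measurable lborel"
    using assms by (auto simp: transversal_L2_def intro!: borel_measurable_times)
  have "\<bar>x * y\<bar> \<le> x\<^sup>2 + y\<^sup>2" for x y :: real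
  proof -
    have "2 * (\<bar>x\<bar> * \<bar>y\<bar>) \<le> x\<^sup>2 + y\<^sup>2"
      using sum_squares_bound[of "\<bar>x\<bar>" "\<bar>y\<bar>"] by simp
    moreover have "0 \<le> \<bar>x\<bar> * \<bar>y\<bar>" by simp
    ultimately have "\<bar>x\<bar> * \<bar>y\<bar> \<le> x\<^sup>2 + y\<^sup>2" by linarith
    then show ?thesis by (simp add: abs_mult)
  qed
  then show "AE k in lborel. norm (f k $ i * g k $ j) \<le> norm ((f k $ i)\<^sup>2 + (g k $ j)\<^sup>2)"
    by simp
qed

lemma transversal_L2_add:
  assumes "transversal_L2 f" "transversal_L2 g"
  shows "transversal_L2 (\<lambda>k. f k + g k)"
proof -
  have "integrable lborel (\<lambda>k. (f k $ j + g k $ j)\<^sup>2)" for j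
    using assms transversal_L2_integrable_prod[OF assms, of j j]
    by (auto simp: power2_sum transversal_L2_def mult.assoc)
  moreover have "AE k in lborel. k \<bullet> (f k + g k) = 0"
  proof -
    have "AE k in lborel. k \<bullet> f k = 0" "AE k in lborel. k \<bullet> g k = 0"
      using assms by (auto simp: transversal_L2_def)
    then show ?thesis by eventually_elim (simp add: inner_add_right)
  qed
  ultimately show ?thesis
    using assms by (auto simp: transversal_L2_def intro!: borel_measurable_add)
qed

lemma transversal_L2_mult:
  assumes "transversal_L2 f" and [measurable]: "m \<in> borel_measurable lborel"
    and bound: "\<And>k. \<bar>m k\<bar> \<le> C"
  shows "transversal_L2 (\<lambda>k. m k *\<^sub>R f k)"
proof -
  have [measurable]: "(\<lambda>k. f k $ j) \<in> borel_measurable lborel" for j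
    using assms by (auto simp: transversal_L2_def)
  have "integrable lborel (\<lambda>k. (m k * f k $ j)\<^sup>2)" for j
  proof (rule Bochner_Integration.integrable_bound)
    show "integrable lborel (\<lambda>k. C\<^sup>2 * (f k $ j)\<^sup>2)"
      using assms by (auto simp: transversal_L2_def)
    show "(\<lambda>k. (m k * f k $ j)\<^sup>2) \<in> borel_measurable lborel"
      by measurable
    have "(m k)\<^sup>2 \<le> C\<^sup>2" for k
      using bound[of k] by (meson abs_ge_zero order_trans abs_le_square_iff abs_ge_self)
    then show "AE k in lborel. norm ((m k * f k $ j)\<^sup>2) \<le> norm (C\<^sup>2 * (f k $ j)\<^sup>2)"
      by (auto simp: power_mult_distrib intro!: mult_right_mono)
  qed
  moreover have "AE k in lborel. k \<bullet> (m k *\<^sub>R f k) = 0"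
    using assms by (auto simp: transversal_L2_def)
  ultimately show ?thesis
    by (auto simp: transversal_L2_def)
qed

lemma transversal_L2_scaleR: "transversal_L2 f \<Longrightarrow> transversal_L2 (\<lambda>k. c *\<^sub>R f k)"
  by (rule transversal_L2_mult[where C = "\<bar>c\<bar>"]) auto

lemma cross3_nth:
  "cross3 x y $ 1 = x$2 * y$3 - y$2 * x$3"
  "cross3 x y $ 2 = x$3 * y$1 - y$3 * x$1"
  "cross3 x y $ 3 = x$1 * y$2 - y$1 * x$2"
  by (simp_all add: cross3_def)

lemma transversal_L2_cross:
  assumes f: "transversal_L2 f"
  shows "transversal_L2 (\<lambda>k. (1 / norm k) *\<^sub>R cross3 k (f k))"
proof -
  define u where "u i k = k $ i / norm k" for i and k :: "real^3"
  have u_meas: "u i \<in> borel_measurable lborel" for i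
    unfolding u_def by (auto intro!: borel_measurable_divide borel_measurable_continuous_onI
        continuous_intros)
  have u_bound: "\<bar>u i k\<bar> \<le> 1" for i k
    using component_le_norm_cart[of k i] by (auto simp: u_def divide_le_eq)
  have uf: "transversal_L2 (\<lambda>k. u i k *\<^sub>R f k)" for i
    by (rule transversal_L2_mult[OF f u_meas u_bound])
  have meas: "(\<lambda>k. u i k * f k $ j) \<in> borel_measurable lborel"
    and sq: "integrable lborel (\<lambda>k. (u i k * f k $ j)\<^sup>2)" for i j
    using uf[of i] by (auto simp: transversal_L2_def)
  have pr: "integrable lborel (\<lambda>k. (u i k * f k $ j) * (u i' k * f k $ j'))" for i j i' j'
    using transversal_L2_integrable_prod[OF uf[of i] uf[of i']] by simp
  have dsq: "integrable lborel (\<lambda>k. (u i k * f k $ j - u i' k * f k $ j')\<^sup>2)" for i j i' j'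
    using sq[of i j] sq[of i' j'] pr[of i j i' j'] by (auto simp: power2_diff mult.assoc)
  have dm: "(\<lambda>k. u i k * f k $ j - u i' k * f k $ j') \<in> borel_measurable lborel" for i j i' j'
    by (intro borel_measurable_diff meas)
  have comp:
    "((1 / norm k) *\<^sub>R cross3 k (f k)) $ 1 = u 2 k * f k $ 3 - u 3 k * f k $ 2"
    "((1 / norm k) *\<^sub>R cross3 k (f k)) $ 2 = u 3 k * f k $ 1 - u 1 k * f k $ 3"
    "((1 / norm k) *\<^sub>R cross3 k (f k)) $ 3 = u 1 k * f k $ 2 - u 2 k * f k $ 1" for k
    by (simp_all add: cross3_nth u_def diff_divide_distrib mult.commute)
  show ?thesis
    unfolding transversal_L2_def forall_3 comp
    using dm dsq by (simp add: dot_cross_self)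
qed

quotient_type transversal_field = "real^3 \<Rightarrow> real^3" / partial: L2_eq
proof (rule part_equivpI)
  show "\<exists>f. L2_eq f f"
    using transversal_L2_zero by (auto simp: L2_eq_def)
  show "symp L2_eq"
    by (rule sympI) (auto simp: L2_eq_def eq_commute)
  show "transp L2_eq"
  proof (rule transpI)
    fix f g h assume a: "L2_eq f g" "L2_eq g h"
    then have "AE k in lborel. f k = g k" "AE k in lborel. g k = h k"
      by (auto simp: L2_eq_def)
    then have "AE k in lborel. f k = h k" by eventually_elim simp
    with a show "L2_eq f h" by (auto simp: L2_eq_def)
  qed
qed

lemma L2_eqI: "transversal_L2 f \<Longrightarrow> transversal_L2 g \<Longrightarrow> (\<And>k. f k = g k) \<Longrightarrow> L2_eq f g"
  by (auto simp: L2_eq_def)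

lemma L2_eq_mult:
  assumes "L2_eq f g" "m \<in> borel_measurable lborel" "\<And>k. \<bar>m k\<bar> \<le> C"
  shows "L2_eq (\<lambda>k. m k *\<^sub>R f k) (\<lambda>k. m k *\<^sub>R g k)"
  using assms transversal_L2_mult[of f m C] transversal_L2_mult[of g m C]
  by (auto simp: L2_eq_def)

lemma L2_eq_add:
  assumes "L2_eq f f'" "L2_eq g g'"
  shows "L2_eq (\<lambda>k. f k + g k) (\<lambda>k. f' k + g' k)"
proof -
  have "AE k in lborel. f k = f' k" "AE k in lborel. g k = g' k"
    using assms by (auto simp: L2_eq_def)
  then have "AE k in lborel. f k + g k = f' k + g' k" by eventually_elim simp
  with assms show ?thesis by (auto simp: L2_eq_def transversal_L2_add)
qed

lemma L2_eq_scaleR: "L2_eq f g \<Longrightarrow> L2_eq (\<lambda>k. c *\<^sub>R f k) (\<lambda>k. c *\<^sub>R g k)"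
  by (rule L2_eq_mult[where C = "\<bar>c\<bar>"]) auto

instantiation transversal_field :: real_inner
begin

lift_definition zero_transversal_field :: transversal_field is "\<lambda>_. 0"
  by (simp add: L2_eq_def transversal_L2_zero)

lift_definition plus_transversal_field ::
  "transversal_field \<Rightarrow> transversal_field \<Rightarrow> transversal_field" is "\<lambda>f g k. f k + g k"
  by (rule L2_eq_add)

lift_definition scaleR_transversal_field ::
  "real \<Rightarrow> transversal_field \<Rightarrow> transversal_field" is "\<lambda>c f k. c *\<^sub>R f k"
  by (rule L2_eq_scaleR)

lift_definition uminus_transversal_field ::
  "transversal_field \<Rightarrow> transversal_field" is "\<lambda>f k. - f k"
  using L2_eq_scaleR[of _ _ "-1"] by simp

lift_definition minus_transversal_field ::
  "transversal_field \<Rightarrow> transversal_field \<Rightarrow> transversal_field" is "\<lambda>f g k. f k - g k"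
  subgoal premises p for f f' g g'
    using L2_eq_add[OF p(1) L2_eq_scaleR[OF p(2), of "-1"]] by simp
  done

lift_definition inner_transversal_field ::
  "transversal_field \<Rightarrow> transversal_field \<Rightarrow> real"
  is "\<lambda>f g. \<Sum>j\<in>UNIV. \<integral>k. f k $ j * g k $ j \<partial>lborel"
  subgoal premises p for f f' g g'
  proof (rule sum.cong[OF refl], rule integral_cong_AE)
    fix j :: 3
    show "(\<lambda>k. f k $ j * g k $ j) \<in> borel_measurable lborel"
      "(\<lambda>k. f' k $ j * g' k $ j) \<in> borel_measurable lborel"
      using p by (auto simp del: measurable_lborel1 measurable_lborel2 simp: L2_eq_def
          intro: borel_measurable_integrable[OF transversal_L2_integrable_prod])
    have "AE k in lborel. f k = f' k" "AE k in lborel. g k = g' k"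
      using p by (auto simp: L2_eq_def)
    then show "AE k in lborel. f k $ j * g k $ j = f' k $ j * g' k $ j"
      by eventually_elim simp
  qed
  done

definition norm_transversal_field :: "transversal_field \<Rightarrow> real" where
  "norm_transversal_field f = sqrt (f \<bullet> f)"

definition dist_transversal_field :: "transversal_field \<Rightarrow> transversal_field \<Rightarrow> real" where
  "dist_transversal_field f g = norm (f - g)"

definition sgn_transversal_field :: "transversal_field \<Rightarrow> transversal_field" where
  "sgn_transversal_field f = inverse (norm f) *\<^sub>R f"

definition uniformity_transversal_field :: "(transversal_field \<times> transversal_field) filter" where
  "uniformity_transversal_field = (INF e\<in>{0<..}. principal {(f, g). dist f g < e})"

definition open_transversal_field :: "transversal_field set \<Rightarrow> bool" where
  "open_transversal_field U \<longleftrightarrow>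
     (\<forall>f\<in>U. eventually (\<lambda>(f', g). f' = f \<longrightarrow> g \<in> U) uniformity)"

instance
proof
  fix f g h :: transversal_field and c d :: real
  show "f + g + h = f + (g + h)"
    by transfer (auto simp: L2_eq_def add.assoc intro!: transversal_L2_add)
  show "f + g = g + f"
    by transfer (auto simp: L2_eq_def add.commute intro!: transversal_L2_add)
  show "0 + f = f"
    by transfer (auto simp: L2_eq_def)
  show "- f + f = 0"
    by transfer (auto simp: L2_eq_def transversal_L2_zero)
  show "f - g = f + - g"
  proof (transfer, goal_cases)
    case (1 f g)
    then show ?case using L2_eq_add[OF 1(1) L2_eq_scaleR[OF 1(2), of "-1"]] by simp
  qed
  show "c *\<^sub>R (f + g) = c *\<^sub>R f + c *\<^sub>R g"
    by transfer (auto simp: L2_eq_def scaleR_add_right intro!: transversal_L2_add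
        transversal_L2_scaleR)
  show "(c + d) *\<^sub>R f = c *\<^sub>R f + d *\<^sub>R f"
    by transfer (auto simp: L2_eq_def scaleR_add_left intro!: transversal_L2_add
        transversal_L2_scaleR)
  show "c *\<^sub>R d *\<^sub>R f = (c * d) *\<^sub>R f"
    by transfer (auto simp: L2_eq_def intro!: transversal_L2_scaleR)
  show "1 *\<^sub>R f = f"
    by transfer simp
  show "sgn f = inverse (norm f) *\<^sub>R f"
    by (rule sgn_transversal_field_def)
  show "dist f g = norm (f - g)"
    by (rule dist_transversal_field_def)
  show "(uniformity :: (transversal_field \<times> transversal_field) filter) =
      (INF e\<in>{0<..}. principal {(f, g). dist f g < e})"
    by (rule uniformity_transversal_field_def)
  show "open U \<longleftrightarrow> (\<forall>f\<in>U. eventually (\<lambda>(f', g). f' = f \<longrightarrow> g \<in> U) uniformity)"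
    for U :: "transversal_field set"
    by (rule open_transversal_field_def)
  show "f \<bullet> g = g \<bullet> f"
    by transfer (simp add: mult.commute)
  show "(f + g) \<bullet> h = f \<bullet> h + g \<bullet> h"
    by transfer (auto simp: L2_eq_def distrib_right transversal_L2_integrable_prod
        simp flip: sum.distrib)
  show "(c *\<^sub>R f) \<bullet> g = c * (f \<bullet> g)"
    by transfer (simp add: mult.assoc sum_distrib_left)
  show "0 \<le> f \<bullet> f"
    by transfer (auto intro!: sum_nonneg)
  show "f \<bullet> f = 0 \<longleftrightarrow> f = 0"
  proof (transfer, goal_cases)
    case (1 f)
    then have f: "transversal_L2 f" by (simp add: L2_eq_def)
    have int: "integrable lborel (\<lambda>k. f k $ j * f k $ j)" for j
      by (rule transversal_L2_integrable_prod[OF f f])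
    have "(\<Sum>j\<in>UNIV. \<integral>k. f k $ j * f k $ j \<partial>lborel) = 0
        \<longleftrightarrow> (\<forall>j. (\<integral>k. f k $ j * f k $ j \<partial>lborel) = 0)"
      by (subst sum_nonneg_eq_0_iff) auto
    also have "\<dots> \<longleftrightarrow> (\<forall>j. AE k in lborel. f k $ j * f k $ j = 0)"
      using int by (subst integral_nonneg_eq_0_iff_AE) auto
    also have "\<dots> \<longleftrightarrow> (AE k in lborel. \<forall>j. f k $ j = 0)"
      by (subst AE_all_countable[symmetric]) auto
    also have "\<dots> \<longleftrightarrow> L2_eq f (\<lambda>_. 0)"
      using f by (simp add: L2_eq_def transversal_L2_zero vec_eq_iff)
    finally show ?case .
  qed
  show "norm f = sqrt (f \<bullet> f)"
    by (rule norm_transversal_field_def)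
qed

end


section \<open>The smoothed field operators\<close>

definition schwartz :: "(real \<Rightarrow> real) \<Rightarrow> bool" where
  "schwartz f \<longleftrightarrow>
     (\<forall>n. (\<forall>r. (deriv ^^ n) f differentiable (at r)) \<and>
          (\<forall>j. \<exists>C. \<forall>r. \<bar>r\<bar> ^ j * \<bar>(deriv ^^ n) f r\<bar> \<le> C))"

text \<open>
  At \<open>k = 0\<close> the quotients by \<open>norm k\<close> are \<open>0\<close>, which is immaterial in \<open>L\<^sup>2\<close>. For a Schwartz
  function \<open>chi\<close> the two functions below satisfy
  \<^const>\<open>transversal_L2\<close>; for other \<open>chi\<close> the class need not be meaningful.
\<close>

definition a_vec :: "(real \<Rightarrow> real) \<Rightarrow> real^3 \<Rightarrow> 3 \<Rightarrow> transversal_field" where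
  "a_vec chi x m = abs_transversal_field (\<lambda>k.
     (chi (norm k) * sqrt (norm k) / (2 * pi) powr (3/2) * sin (k \<bullet> x)) *\<^sub>R
       ((1 / norm k) *\<^sub>R cross3 k (axis m 1)))"

definition b_vec :: "(real \<Rightarrow> real) \<Rightarrow> real^3 \<Rightarrow> 3 \<Rightarrow> transversal_field" where
  "b_vec chi x m = abs_transversal_field (\<lambda>k.
     (chi (norm k) * sqrt (norm k) / (2 * pi) powr (3/2) * cos (k \<bullet> x)) *\<^sub>R
       ((1 / norm k) *\<^sub>R cross3 k (axis m 1)))"

lift_definition helicity :: "transversal_field \<Rightarrow> transversal_field"
  is "\<lambda>f k. (1 / norm k) *\<^sub>R cross3 k (f k)"
  by (auto simp: L2_eq_def intro: transversal_L2_cross)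

definition J_map ::
  "transversal_field \<times> transversal_field \<Rightarrow> transversal_field \<times> transversal_field" where
  "J_map X = (helicity (fst X), helicity (snd X))"

definition B_form ::
  "(real \<Rightarrow> real) \<Rightarrow> 3 \<Rightarrow> real^3 \<Rightarrow> transversal_field \<times> transversal_field \<Rightarrow> real" where
  "B_form chi m x X = a_vec chi x m \<bullet> fst X + b_vec chi x m \<bullet> snd X"

definition E_form ::
  "(real \<Rightarrow> real) \<Rightarrow> 3 \<Rightarrow> real^3 \<Rightarrow> transversal_field \<times> transversal_field \<Rightarrow> real" where
  "E_form chi m x X = - B_form chi m x (J_map X)"

lift_definition cos_mult :: "real \<Rightarrow> transversal_field \<Rightarrow> transversal_field"
  is "\<lambda>t f k. cos (t * norm k) *\<^sub>R f k"
  by (rule L2_eq_mult[where C = 1]) auto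

lift_definition sin_mult :: "real \<Rightarrow> transversal_field \<Rightarrow> transversal_field"
  is "\<lambda>t f k. sin (t * norm k) *\<^sub>R f k"
  by (rule L2_eq_mult[where C = 1]) auto

definition free_evolution ::
  "real \<Rightarrow> transversal_field \<times> transversal_field \<Rightarrow> transversal_field \<times> transversal_field" where
  "free_evolution t X =
     (cos_mult t (fst X) + sin_mult t (snd X), - sin_mult t (fst X) + cos_mult t (snd X))"


section \<open>Spins\<close>

text \<open>
  \<open>(\<complex>\<^sup>2)\<^sup>\<otimes>\<^sup>N\<close>, with the \<open>N\<close> factors labelled by the finite type \<open>'n\<close>, is the space of vectors
  indexed by the spin configurations \<open>'n \<Rightarrow> 2\<close>: the configuration \<open>s\<close> labels the product basis
  vector with factor \<open>s \<lambda>\<close> at place \<open>\<lambda>\<close>.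
\<close>

type_synonym 'n spin_space = "complex ^ ('n \<Rightarrow> 2)"
type_synonym 'n spin_matrix = "complex ^ ('n \<Rightarrow> 2) ^ ('n \<Rightarrow> 2)"

definition pauli :: "3 \<Rightarrow> complex^2^2" where
  "pauli m =
     (if m = 1 then vector [vector [0, 1], vector [1, 0]]
      else if m = 2 then vector [vector [0, - \<i>], vector [\<i>, 0]]
      else vector [vector [1, 0], vector [0, - 1]])"

definition tensor_matrix :: "('n::finite \<Rightarrow> complex^2^2) \<Rightarrow> 'n spin_matrix" where
  "tensor_matrix A = (\<chi> s s'. \<Prod>\<mu>\<in>UNIV. A \<mu> $ s \<mu> $ s' \<mu>)"

definition sigma :: "'n::finite \<Rightarrow> 3 \<Rightarrow> 'n spin_matrix" where
  "sigma l m = tensor_matrix (\<lambda>\<mu>. if \<mu> = l then pauli m else mat 1)"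

text \<open>Linear in the first argument, so that \<open>\<pi>\<^sub>a(i \<sigma>) = \<langle>\<sigma> a, a\<rangle>\<close>.\<close>

definition cinner :: "complex ^ 'i \<Rightarrow> complex ^ 'i \<Rightarrow> complex" where
  "cinner u v = (\<Sum>i\<in>UNIV. u $ i * cnj (v $ i))"

definition cadjoint :: "complex ^ 'i ^ 'j \<Rightarrow> complex ^ 'j ^ 'i" where
  "cadjoint A = (\<chi> i j. cnj (A $ j $ i))"

lemma cadjoint_add: "cadjoint (A + B) = cadjoint A + cadjoint B"
  and cadjoint_diff: "cadjoint (A - B) = cadjoint A - cadjoint B"
  and cadjoint_minus: "cadjoint (- A) = - cadjoint A"
  and cadjoint_scaleR: "cadjoint (c *\<^sub>R A) = c *\<^sub>R cadjoint A"
  and cadjoint_zero: "cadjoint 0 = 0"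
  by (simp_all add: cadjoint_def vec_eq_iff)

lemma cadjoint_mult:
  fixes A :: "complex ^ 'i::finite ^ 'j" and B :: "complex ^ 'k ^ 'i"
  shows "cadjoint (A ** B) = cadjoint B ** cadjoint A"
  by (simp add: cadjoint_def matrix_matrix_mult_def vec_eq_iff mult.commute)

lemma trace_scaleR: "trace (c *\<^sub>R A) = c *\<^sub>R trace (A :: complex ^ 'i ^ 'i)"
  by (simp add: trace_def scaleR_sum_right)

text \<open>The Lie algebra of \<open>SU\<close>, normed by the Euclidean norm of the matrix entries.\<close>

typedef (overloaded) 'n su =
  "{Y :: 'n::finite spin_matrix. cadjoint Y = - Y \<and> trace Y = 0}"
  by (rule exI[of _ 0]) (simp add: cadjoint_zero trace_def)

setup_lifting type_definition_su

instantiation su :: (finite) real_normed_vector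
begin

lift_definition zero_su :: "'a su" is 0
  by (simp add: cadjoint_zero trace_def)

lift_definition plus_su :: "'a su \<Rightarrow> 'a su \<Rightarrow> 'a su" is "(+)"
  by (simp add: cadjoint_add trace_add)

lift_definition minus_su :: "'a su \<Rightarrow> 'a su \<Rightarrow> 'a su" is "(-)"
  by (simp add: cadjoint_diff trace_sub)

lift_definition uminus_su :: "'a su \<Rightarrow> 'a su" is uminus
  by (simp add: cadjoint_minus trace_def sum_negf)

lift_definition scaleR_su :: "real \<Rightarrow> 'a su \<Rightarrow> 'a su" is "(*\<^sub>R)"
  by (simp add: cadjoint_scaleR trace_scaleR)

lift_definition norm_su :: "'a su \<Rightarrow> real" is norm .

definition dist_su :: "'a su \<Rightarrow> 'a su \<Rightarrow> real" where
  "dist_su Y Z = norm (Y - Z)"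

definition sgn_su :: "'a su \<Rightarrow> 'a su" where
  "sgn_su Y = inverse (norm Y) *\<^sub>R Y"

definition uniformity_su :: "('a su \<times> 'a su) filter" where
  "uniformity_su = (INF e\<in>{0<..}. principal {(Y, Z). dist Y Z < e})"

definition open_su :: "'a su set \<Rightarrow> bool" where
  "open_su U \<longleftrightarrow> (\<forall>Y\<in>U. eventually (\<lambda>(Y', Z). Y' = Y \<longrightarrow> Z \<in> U) uniformity)"

instance
proof
  fix Y Z W :: "'a su" and c d :: real
  show "Y + Z + W = Y + (Z + W)" by transfer simp
  show "Y + Z = Z + Y" by transfer simp
  show "0 + Y = Y" by transfer simp
  show "- Y + Y = 0" by transfer simp
  show "Y - Z = Y + - Z" by transfer simp
  show "c *\<^sub>R (Y + Z) = c *\<^sub>R Y + c *\<^sub>R Z" by transfer (rule scaleR_add_right)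
  show "(c + d) *\<^sub>R Y = c *\<^sub>R Y + d *\<^sub>R Y" by transfer (rule scaleR_add_left)
  show "c *\<^sub>R d *\<^sub>R Y = (c * d) *\<^sub>R Y" by transfer simp
  show "1 *\<^sub>R Y = Y" by transfer simp
  show "sgn Y = inverse (norm Y) *\<^sub>R Y" by (rule sgn_su_def)
  show "dist Y Z = norm (Y - Z)" by (rule dist_su_def)
  show "(uniformity :: ('a su \<times> 'a su) filter) =
      (INF e\<in>{0<..}. principal {(Y, Z). dist Y Z < e})"
    by (rule uniformity_su_def)
  show "open U \<longleftrightarrow> (\<forall>Y\<in>U. eventually (\<lambda>(Y', Z). Y' = Y \<longrightarrow> Z \<in> U) uniformity)"
    for U :: "'a su set"
    by (rule open_su_def)
  show "norm Y = 0 \<longleftrightarrow> Y = 0" by transfer simp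
  show "norm (Y + Z) \<le> norm Y + norm Z" by transfer (rule norm_triangle_ineq)
  show "norm (c *\<^sub>R Y) = \<bar>c\<bar> * norm Y" by transfer simp
qed

end

lift_definition su_bracket :: "'n::finite su \<Rightarrow> 'n su \<Rightarrow> 'n su" is "\<lambda>Y Z. Y ** Z - Z ** Y"
  subgoal for Y Z
    using trace_mul_sym[of Y Z]
    by (simp add: cadjoint_diff cadjoint_mult trace_sub)
      (simp add: matrix_matrix_mult_def vec_eq_iff sum_negf)
  done

lemma sum_prod_config:
  fixes F :: "'n::finite \<Rightarrow> 2 \<Rightarrow> complex"
  shows "(\<Sum>s\<in>UNIV. \<Prod>\<mu>\<in>UNIV. F \<mu> (s \<mu>)) = (\<Prod>\<mu>\<in>UNIV. \<Sum>i\<in>UNIV. F \<mu> i)"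
  using prod_sum_PiE[of UNIV "\<lambda>_. UNIV" F] by (simp add: PiE_UNIV_domain)

lemma trace_tensor_matrix: "trace (tensor_matrix A) = (\<Prod>\<mu>\<in>UNIV. trace (A \<mu>))"
  using sum_prod_config[of "\<lambda>\<mu> i. A \<mu> $ i $ i"] by (simp add: trace_def tensor_matrix_def)

lemma cadjoint_tensor_matrix: "cadjoint (tensor_matrix A) = tensor_matrix (\<lambda>\<mu>. cadjoint (A \<mu>))"
  by (simp add: cadjoint_def tensor_matrix_def vec_eq_iff)

lemma trace_pauli: "trace (pauli m) = 0"
  by (simp add: trace_def pauli_def sum_2)

lemma cadjoint_pauli: "cadjoint (pauli m) = pauli m"
  by (simp add: cadjoint_def pauli_def vec_eq_iff forall_2)

lemma trace_sigma: "trace (sigma l m) = 0"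
  unfolding sigma_def trace_tensor_matrix by (rule prod_zero) (auto intro!: bexI[of _ l] simp: trace_pauli)

lemma cadjoint_sigma: "cadjoint (sigma l m) = sigma l m"
proof -
  have "cadjoint (mat 1 :: complex^2^2) = mat 1"
    by (simp add: cadjoint_def mat_def vec_eq_iff)
  then show ?thesis
    by (simp add: sigma_def cadjoint_tensor_matrix if_distrib[of cadjoint] cadjoint_pauli cong: if_cong)
qed

lift_definition i_sigma :: "'n::finite \<Rightarrow> 3 \<Rightarrow> 'n su"
  is "\<lambda>l m. \<chi> s s'. \<i> * sigma l m $ s $ s'"
  subgoal for l m
  proof
    have "cnj (sigma l m $ s' $ s) = sigma l m $ s $ s'" for s s'
      using arg_cong[OF cadjoint_sigma[of l m], of "\<lambda>A. A $ s $ s'"] by (simp add: cadjoint_def)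
    then show "cadjoint (\<chi> s s'. \<i> * sigma l m $ s $ s') = - (\<chi> s s'. \<i> * sigma l m $ s $ s')"
      by (simp add: cadjoint_def vec_eq_iff)
    show "trace (\<chi> s s'. \<i> * sigma l m $ s $ s') = 0"
      using trace_sigma[of l m] by (simp add: trace_def flip: sum_distrib_left)
  qed
  done

text \<open>The dual of the Lie algebra: all linear forms on this finite-dimensional space are bounded.\<close>

type_synonym 'n su_dual = "'n su \<Rightarrow>\<^sub>L real"

definition pure_states :: "'n::finite su_dual set" where
  "pure_states = {w. \<exists>a :: 'n spin_space. norm a = 1 \<and>
     (\<forall>Y. complex_of_real (blinfun_apply w Y) = inverse \<i> * cinner (Rep_su Y *v a) a)}"


section \<open>Weak solutions\<close>

text \<open>The integral from \<open>0\<close> to \<open>t\<close>, with either sign of \<open>t\<close>.\<close>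

definition has_integral_from_0 ::
  "(real \<Rightarrow> 'a::real_normed_vector) \<Rightarrow> 'a \<Rightarrow> real \<Rightarrow> bool" where
  "has_integral_from_0 f I t \<longleftrightarrow>
     (if 0 \<le> t then (f has_integral I) {0..t} else (f has_integral (- I)) {t..0})"

definition Q_source ::
  "(real \<Rightarrow> real) \<Rightarrow> real \<Rightarrow> ('n::finite \<Rightarrow> real^3) \<Rightarrow> 'n su_dual \<Rightarrow> transversal_field" where
  "Q_source chi h xs w =
     h *\<^sub>R (\<Sum>l\<in>UNIV. \<Sum>m\<in>UNIV. blinfun_apply w (i_sigma l m) *\<^sub>R b_vec chi (xs l) m)"

definition P_source ::
  "(real \<Rightarrow> real) \<Rightarrow> real \<Rightarrow> ('n::finite \<Rightarrow> real^3) \<Rightarrow> 'n su_dual \<Rightarrow> transversal_field" where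
  "P_source chi h xs w =
     - (h *\<^sub>R (\<Sum>l\<in>UNIV. \<Sum>m\<in>UNIV. blinfun_apply w (i_sigma l m) *\<^sub>R a_vec chi (xs l) m))"

definition weak_solution ::
  "(real \<Rightarrow> real) \<Rightarrow> real \<Rightarrow> ('n::finite \<Rightarrow> real^3) \<Rightarrow> real^3 \<Rightarrow>
   (real \<Rightarrow> transversal_field \<times> transversal_field) \<Rightarrow> (real \<Rightarrow> 'n su_dual) \<Rightarrow> bool" where
  "weak_solution chi h xs \<beta> X \<omega> \<longleftrightarrow>
     continuous_on UNIV (\<lambda>t. (X t, \<omega> t)) \<and>
     (\<forall>t. has_integral_from_0
        (\<lambda>s. free_evolution (t - s) (Q_source chi h xs (\<omega> s), P_source chi h xs (\<omega> s)))
        (X t - free_evolution t (X 0)) t) \<and>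
     (\<forall>Y t. has_integral_from_0
        (\<lambda>s. \<Sum>l\<in>UNIV. \<Sum>m\<in>UNIV. (\<beta> $ m + B_form chi m (xs l) (X s)) *
                blinfun_apply (\<omega> s) (su_bracket (i_sigma l m) Y))
        (blinfun_apply (\<omega> t) Y - blinfun_apply (\<omega> 0) Y) t)"


section \<open>Vector calculus\<close>

definition partial_deriv :: "3 \<Rightarrow> (real^3 \<Rightarrow> real) \<Rightarrow> real^3 \<Rightarrow> real" where
  "partial_deriv j f x = deriv (\<lambda>s. f (x + s *\<^sub>R axis j 1)) 0"

definition grad :: "(real^3 \<Rightarrow> real) \<Rightarrow> real^3 \<Rightarrow> real^3" where
  "grad f x = (\<chi> j. partial_deriv j f x)"

definition div_field :: "(real^3 \<Rightarrow> real^3) \<Rightarrow> real^3 \<Rightarrow> real" where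
  "div_field F x = (\<Sum>j\<in>UNIV. partial_deriv j (\<lambda>y. F y $ j) x)"

definition rot :: "(real^3 \<Rightarrow> real^3) \<Rightarrow> real^3 \<Rightarrow> real^3" where
  "rot F x = vector
     [partial_deriv 2 (\<lambda>y. F y $ 3) x - partial_deriv 3 (\<lambda>y. F y $ 2) x,
      partial_deriv 3 (\<lambda>y. F y $ 1) x - partial_deriv 1 (\<lambda>y. F y $ 3) x,
      partial_deriv 1 (\<lambda>y. F y $ 2) x - partial_deriv 2 (\<lambda>y. F y $ 1) x]"


section \<open>The approximating fields\<close>

definition B_appr ::
  "(real \<Rightarrow> real) \<Rightarrow> (real \<Rightarrow> transversal_field \<times> transversal_field) \<Rightarrow> real^3 \<Rightarrow> real \<Rightarrow> real^3" where
  "B_appr chi X x t = (\<chi> m. B_form chi m x (X t))"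

definition E_appr ::
  "(real \<Rightarrow> real) \<Rightarrow> (real \<Rightarrow> transversal_field \<times> transversal_field) \<Rightarrow> real^3 \<Rightarrow> real \<Rightarrow> real^3" where
  "E_appr chi X x t = (\<chi> m. E_form chi m x (X t))"

definition S_appr :: "(real \<Rightarrow> 'n::finite su_dual) \<Rightarrow> 'n \<Rightarrow> real \<Rightarrow> real^3" where
  "S_appr \<omega> l t = (\<chi> m. blinfun_apply (\<omega> t) (i_sigma l m))"

definition rho :: "(real \<Rightarrow> real) \<Rightarrow> real^3 \<Rightarrow> real" where
  "rho chi x = (1 / (2 * pi) ^ 3) * (\<integral>k. \<bar>chi (norm k)\<bar>\<^sup>2 * cos (k \<bullet> x) \<partial>lborel)"

end

(*
  All three functions B, E and rho are superpositions of plane waves whose amplitudes decay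
  so fast that they may be differentiated under the integral sign in x.  In t, the mild solution
  is pulled back by the free evolution to Y(t) = R_(-t) X(t); then (g, X(t)) = (R_(-t) g, Y(t)),
  where R_(-t) g is norm differentiable for such amplitudes g and Y is weakly differentiable.
  Since E(X) = B(-J X) and J commutes with the free evolution, one computation serves both fields;
  the source terms are the integrals of sin (k . (x - x_l)) against an even and an odd amplitude,
  i.e. 0 and a component of grad rho.

  For the spins, the density matrix r of omega(t) solves r' = [r, A] with A antihermitian, so
  D = r r - r solves D' = [D, A], and the trace of D D, which is the squared norm of D, is constant.
  Hence r stays a projection of trace 1.
*)

theory Submission
  imports Defs
begin

section \<open>Preservation of pure states\<close>

text \<open>Two obstacles shape the proof. The fields lie only in H, where M is unbounded, so X need
  not be differentiable in norm; derivatives in time are therefore taken after pairing with an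
  amplitude. The Schwartz decay of \<chi> puts the amplitudes into the domain of every power of M,
  and their second moments control all Taylor remainders by an explicit constant, both in t and in
  x. On the spin side \<omega> is a real form on traceless antihermitian matrices and has no value
  on the identity. A form \<pi>_a sends Y to Im <Ya, a>; on the traceless antihermitian parts of M
  and of iM it therefore yields the imaginary and the real part of <Ma, a>, up to tr M / 2^N. Adding
  this trace term normalises the extension to 1 on the identity. It is complex linear, hence the
  trace pairing with a matrix, and that matrix exists for every \<omega>, so purity becomes the
  algebraic condition r r = r. That the curl of E returns the time derivative of B rests on J J =
  -1, which is where transversality of the fields enters.\<close>

definition mscale :: "complex \<Rightarrow> complex^'i^'j \<Rightarrow> complex^'i^'j" where
  "mscale c M = (\<chi> i j. c * M $ i $ j)"

definition unit_matrix :: "'j \<Rightarrow> 'i \<Rightarrow> complex^'i^'j" where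
  "unit_matrix r c = (\<chi> i j. if i = r \<and> j = c then 1 else 0)"

lemma cadjoint_mscale: "cadjoint (mscale c M) = mscale (cnj c) (cadjoint M)"
  by (simp add: cadjoint_def mscale_def)

lemma cadjoint_cadjoint [simp]: "cadjoint (cadjoint M) = M"
  by (simp add: cadjoint_def)

lemma trace_mscale: "trace (mscale c M) = c * trace M"
  by (simp add: trace_def mscale_def sum_distrib_left)

lemma trace_cadjoint: "trace (cadjoint M) = cnj (trace M)"
  by (simp add: trace_def cadjoint_def)

lemma trace_unit_matrix_mult:
  fixes N :: "complex^'i::finite^'i"
  shows "trace (unit_matrix r c ** N) = N $ c $ r"
proof -
  have "trace (unit_matrix r c ** N) = (\<Sum>i\<in>UNIV. \<Sum>k\<in>UNIV. if i = r then (if k = c then N $ k $ i else 0) else 0)"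
    by (auto simp: trace_def matrix_matrix_mult_def unit_matrix_def intro!: sum.cong)
  also have "\<dots> = (\<Sum>i\<in>UNIV. if i = r then N $ c $ i else 0)"
    by (intro sum.cong refl) simp
  finally show ?thesis by simp
qed

text \<open>The trace of an antihermitian matrix is purely imaginary, so the subtracted multiple of
  the identity is itself antihermitian.\<close>

lemma cadjoint_diff_mat_trace:
  fixes K :: "complex^'i::finite^'i"
  assumes K: "cadjoint K = - K"
  shows "cadjoint (K - mat (trace K / of_nat n)) = - (K - mat (trace K / of_nat n))"
proof -
  have "trace (- K) = - trace K" by (simp add: trace_def sum_negf)
  then have tr: "cnj (trace K) = - trace K"
    by (metis K trace_cadjoint)
  have "cadjoint (mat (trace K / of_nat n) :: complex^'i^'i) = - mat (trace K / of_nat n)"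
    by (simp add: cadjoint_def mat_def vec_eq_iff tr)
  then show ?thesis
    unfolding cadjoint_diff K minus_diff_eq by simp
qed

section \<open>Extending forms from the Lie algebra to all matrices\<close>

lemma trace_mat: "trace (mat c :: 'a::comm_semiring_1^'i^'i) = of_nat CARD('i) * c"
  by (simp add: trace_def mat_def)

text \<open>The real-linear projection of all matrices onto the Lie algebra: the antihermitian part
  with its trace removed. \<open>CARD('n \<Rightarrow> 2)\<close> is the dimension 2^N of the spin
  space.\<close>

lift_definition su_part :: "'n::finite spin_matrix \<Rightarrow> 'n su" is
  "\<lambda>M. (1/2) *\<^sub>R (M - cadjoint M)
     - mat (trace ((1/2) *\<^sub>R (M - cadjoint M)) / of_nat CARD('n \<Rightarrow> 2))"
proof
  fix M :: "'n spin_matrix"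
  show "cadjoint ((1/2) *\<^sub>R (M - cadjoint M) - mat (trace ((1/2) *\<^sub>R (M - cadjoint M)) / of_nat CARD('n \<Rightarrow> 2))) =
      - ((1/2) *\<^sub>R (M - cadjoint M) - mat (trace ((1/2) *\<^sub>R (M - cadjoint M)) / of_nat CARD('n \<Rightarrow> 2)))"
    by (rule cadjoint_diff_mat_trace) (simp add: cadjoint_scaleR cadjoint_diff flip: scaleR_minus_right)
  show "trace ((1/2) *\<^sub>R (M - cadjoint M) - mat (trace ((1/2) *\<^sub>R (M - cadjoint M)) / of_nat CARD('n \<Rightarrow> 2))) = 0"
    by (simp add: trace_sub trace_mat del: card_fun)
qed

lemma mat_add: "mat (c + d) = mat c + (mat d :: 'a::comm_monoid_add^'i^'i)"
  by (simp add: mat_def vec_eq_iff)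

lemma mat_scaleR: "mat (c *\<^sub>R z) = c *\<^sub>R (mat z :: 'a::real_vector^'i^'i)"
  by (simp add: mat_def vec_eq_iff)

lemma su_part_add: "su_part (M + N) = su_part M + su_part N"
proof -
  have "(1/2::real) *\<^sub>R (M + N - cadjoint (M + N))
      = (1/2) *\<^sub>R (M - cadjoint M) + (1/2) *\<^sub>R (N - cadjoint N)"
    unfolding cadjoint_add by (simp add: algebra_simps)
  then have "Rep_su (su_part (M + N)) = Rep_su (su_part M + su_part N)"
    unfolding su_part.rep_eq plus_su.rep_eq by (simp only: trace_add add_divide_distrib mat_add add_diff_add)
  then show ?thesis by (simp only: Rep_su_inject)
qed

lemma su_part_scaleR: "su_part (c *\<^sub>R M) = c *\<^sub>R su_part M"
proof -
  have scaleR_over: "(c *\<^sub>R z) / w = c *\<^sub>R (z / w)" for z w :: complex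
    by (simp add: scaleR_conv_of_real)
  have "(1/2::real) *\<^sub>R (c *\<^sub>R M - cadjoint (c *\<^sub>R M)) = c *\<^sub>R ((1/2) *\<^sub>R (M - cadjoint M))"
    unfolding cadjoint_scaleR by (simp add: algebra_simps)
  then have "Rep_su (su_part (c *\<^sub>R M)) = Rep_su (c *\<^sub>R su_part M)"
    unfolding su_part.rep_eq scaleR_su.rep_eq
    by (simp only: trace_scaleR scaleR_over mat_scaleR scaleR_diff_right[where y = "mat _"])
  then show ?thesis by (simp only: Rep_su_inject)
qed

lemma su_part_hermitian: "cadjoint M = M \<Longrightarrow> su_part M = 0"
  by transfer (simp add: trace_def vec_eq_iff mat_def)

text \<open>M plus its adjoint is hermitian and so has no component in the Lie algebra.\<close>

lemma su_part_cadjoint: "su_part (cadjoint M) = - su_part M"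
  using su_part_add[of M "cadjoint M"] su_part_hermitian[of "M + cadjoint M"]
  by (simp add: cadjoint_add add.commute eq_neg_iff_add_eq_0)

lemma su_part_Rep_su: "su_part (Rep_su Y) = Y"
proof -
  have "cadjoint (Rep_su Y) = - Rep_su Y" "trace (Rep_su Y) = 0"
    using Rep_su[of Y] by auto
  then have "(1/2::real) *\<^sub>R (Rep_su Y - cadjoint (Rep_su Y)) = Rep_su Y" "trace (Rep_su Y) = 0"
    by (simp_all flip: scaleR_2)
  then have "Rep_su (su_part (Rep_su Y)) = Rep_su Y"
    unfolding su_part.rep_eq by (simp only:) (simp add: mat_def vec_eq_iff)
  then show ?thesis by (simp add: Rep_su_inject)
qed

lemma matrix_diff_ldistrib:
  fixes A :: "'a::ring_1 ^ 'i ^ 'j"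
  shows "A ** (B - C) = A ** B - A ** C"
  by (simp add: vec_eq_iff matrix_matrix_mult_def algebra_simps sum_subtractf)

lemma matrix_diff_rdistrib:
  fixes A :: "'a::ring_1 ^ 'i ^ 'j"
  shows "(A - B) ** C = A ** C - B ** C"
  by (simp add: vec_eq_iff matrix_matrix_mult_def algebra_simps sum_subtractf)

lemma matrix_add_rdistrib:
  fixes A :: "'a::semiring_1 ^ 'i ^ 'j"
  shows "(A + B) ** C = A ** C + B ** C"
  by (simp add: vec_eq_iff matrix_matrix_mult_def algebra_simps sum.distrib)

lemma matrix_scaleR_right: "A ** (c *\<^sub>R B) = c *\<^sub>R (A ** B)"
  for A :: "'a::real_algebra_1 ^ 'i ^ 'j"
  by (simp add: vec_eq_iff matrix_matrix_mult_def scaleR_sum_right)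

lemma matrix_scaleR_left: "(c *\<^sub>R A) ** B = c *\<^sub>R (A ** B)"
  for A :: "'a::real_algebra_1 ^ 'i ^ 'j"
  by (simp add: vec_eq_iff matrix_matrix_mult_def scaleR_sum_right)

lemma mat_mult_commute: "mat (c::'a::comm_semiring_1) ** M = M ** mat c"
  by (simp add: vec_eq_iff matrix_matrix_mult_def mat_def if_distrib if_distribR mult.commute cong: if_cong)

text \<open>The commutator with an antihermitian matrix commutes with taking the antihermitian part,
  and it kills the multiple of the identity that \<open>su_part\<close> subtracts. Commutators are
  traceless, so the trace correction on the right is 0.\<close>

lemma su_bracket_su_part:
  "su_bracket A (su_part M) = su_part (Rep_su A ** M - M ** Rep_su A)"
proof -
  have A: "cadjoint (Rep_su A) = - Rep_su A" using Rep_su[of A] by auto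
  have adj: "cadjoint (Rep_su A ** M - M ** Rep_su A)
      = Rep_su A ** cadjoint M - cadjoint M ** Rep_su A"
    by (simp add: cadjoint_diff cadjoint_mult A) (simp add: vec_eq_iff matrix_matrix_mult_def sum_negf)
  define K where "K = (1/2::real) *\<^sub>R (M - cadjoint M)"
  define c where "c = trace K / of_nat CARD('a \<Rightarrow> 2)"
  have K2: "Rep_su A ** K - K ** Rep_su A
     = (1/2::real) *\<^sub>R ((Rep_su A ** M - M ** Rep_su A) - cadjoint (Rep_su A ** M - M ** Rep_su A))"
    unfolding adj K_def
    by (simp add: matrix_scaleR_left matrix_scaleR_right matrix_diff_ldistrib matrix_diff_rdistrib
        flip: scaleR_diff_right)
  have tr: "trace (Rep_su A ** K - K ** Rep_su A) = 0"
    using trace_mul_sym[of "Rep_su A" K] by (simp add: trace_sub)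
  have "Rep_su (su_bracket A (su_part M)) = Rep_su A ** (K - mat c) - (K - mat c) ** Rep_su A"
    by (simp add: su_bracket.rep_eq su_part.rep_eq K_def c_def)
  also have "\<dots> = Rep_su A ** K - K ** Rep_su A"
    using mat_mult_commute[of c "Rep_su A"]
    by (simp add: matrix_diff_ldistrib matrix_diff_rdistrib)
  also have "\<dots> = Rep_su (su_part (Rep_su A ** M - M ** Rep_su A))"
    using tr unfolding K2 su_part.rep_eq by (simp add: vec_eq_iff mat_def)
  finally show ?thesis by (simp add: Rep_su_inject)
qed

text \<open>The complex-linear functional that equals \<open>M \<mapsto> \<langle>M a, a\<rangle>\<close> for \<open>w = \<pi>\<^sub>a\<close>.\<close>

definition state_form :: "'n::finite su_dual \<Rightarrow> 'n spin_matrix \<Rightarrow> complex" where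
  "state_form w M = trace M / of_nat CARD('n \<Rightarrow> 2)
     + of_real (blinfun_apply w (su_part (mscale \<i> M)))
     + \<i> * of_real (blinfun_apply w (su_part M))"

text \<open>The indices of the matrix unit are exchanged so that \<open>state_form\<close> becomes
  the trace pairing with this matrix, without a transpose.\<close>

definition density_matrix :: "'n::finite su_dual \<Rightarrow> 'n spin_matrix" where
  "density_matrix w = (\<chi> i j. state_form w (unit_matrix j i))"

lemma state_form_add: "state_form w (M + N) = state_form w M + state_form w N"
proof -
  have "mscale \<i> (M + N) = mscale \<i> M + mscale \<i> N"
    by (simp add: mscale_def vec_eq_iff algebra_simps)
  then show ?thesis
    by (simp add: state_form_def su_part_add blinfun.add_right trace_add add_divide_distrib algebra_simps)
qed

lemma state_form_scaleR: "state_form w (c *\<^sub>R M) = c *\<^sub>R state_form w M"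
proof -
  have "mscale \<i> (c *\<^sub>R M) = c *\<^sub>R mscale \<i> M"
    by (simp add: mscale_def vec_eq_iff algebra_simps)
  then show ?thesis
    by (simp add: state_form_def su_part_scaleR blinfun.scaleR_right trace_scaleR scaleR_add_right)
      (simp add: scaleR_conv_of_real[where 'a=complex])
qed

text \<open>Real linearity is known, so only the factor i remains: it exchanges the two Lie algebra
  terms of \<open>state_form\<close>, with the sign of i i = -1.\<close>

lemma state_form_mscale: "state_form w (mscale c M) = c * state_form w M"
proof -
  have "mscale \<i> (mscale \<i> M) = (-1::real) *\<^sub>R M"
    by (simp add: mscale_def vec_eq_iff)
  then have i: "state_form w (mscale \<i> M) = \<i> * state_form w M"
    unfolding state_form_def by (simp add: su_part_scaleR[of "-1", simplified] blinfun.minus_right trace_mscale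
      algebra_simps)
  have "mscale c M = Re c *\<^sub>R M + Im c *\<^sub>R mscale \<i> M"
    by (simp add: mscale_def vec_eq_iff complex_eq_iff)
  then show ?thesis
    by (simp add: state_form_add state_form_scaleR i) (simp add: complex_eq_iff)
qed

lemma state_form_eq_trace: "state_form w M = trace (M ** density_matrix w)"
proof -
  have lin: "linear (state_form w)"
    by (rule linearI) (simp_all add: state_form_add state_form_scaleR)
  have "(\<Sum>r\<in>UNIV. \<Sum>c\<in>UNIV. mscale (M $ r $ c) (unit_matrix r c)) $ i $ j = M $ i $ j" for i j
  proof -
    have "(\<Sum>r\<in>UNIV. \<Sum>c\<in>UNIV. mscale (M $ r $ c) (unit_matrix r c)) $ i $ j
      = (\<Sum>r\<in>UNIV. \<Sum>c\<in>UNIV. if r = i then (if c = j then M $ r $ c else 0) else 0)"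
      by (simp add: mscale_def unit_matrix_def) (auto intro!: sum.cong)
    also have "\<dots> = (\<Sum>r\<in>UNIV. if r = i then M $ r $ j else 0)"
      by (intro sum.cong refl) simp
    finally show ?thesis by simp
  qed
  then have M: "M = (\<Sum>r\<in>UNIV. \<Sum>c\<in>UNIV. mscale (M $ r $ c) (unit_matrix r c))"
    by (simp add: vec_eq_iff)
  have "state_form w M = (\<Sum>r\<in>UNIV. \<Sum>c\<in>UNIV. M $ r $ c * state_form w (unit_matrix r c))"
    by (subst M) (simp add: linear_sum[OF lin] state_form_mscale)
  then show ?thesis
    by (simp add: trace_def matrix_matrix_mult_def density_matrix_def)
qed

text \<open>Passing to the adjoint reverses \<open>su_part\<close> of M and keeps
  \<open>su_part\<close> of iM, because i times the adjoint of M is minus the adjoint of iM. This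
  makes the density matrix hermitian.\<close>

lemma state_form_cadjoint: "state_form w (cadjoint M) = cnj (state_form w M)"
proof -
  have "mscale \<i> (cadjoint M) = - cadjoint (mscale \<i> M)"
    by (simp add: mscale_def cadjoint_def vec_eq_iff)
  moreover have "su_part (- cadjoint (mscale \<i> M)) = su_part (mscale \<i> M)"
    using su_part_scaleR[of "-1" "cadjoint (mscale \<i> M)"] by (simp add: su_part_cadjoint)
  ultimately show ?thesis
    by (simp add: state_form_def su_part_cadjoint blinfun.minus_right trace_cadjoint)
qed

lemma cadjoint_density_matrix: "cadjoint (density_matrix w) = density_matrix w"
proof -
  have "cadjoint (unit_matrix i j) = unit_matrix j i" for i :: "'a \<Rightarrow> 2" and j :: "'a \<Rightarrow> 2"
    by (simp add: cadjoint_def unit_matrix_def vec_eq_iff)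
  then show ?thesis
    by (simp add: cadjoint_def[of "density_matrix w"])
      (simp add: density_matrix_def flip: state_form_cadjoint)
qed

text \<open>Neither the identity nor i times it has a component in the Lie algebra; the trace term
  of \<open>state_form\<close> alone gives the value 1.\<close>

lemma trace_density_matrix: "trace (density_matrix (w :: 'n::finite su_dual)) = 1"
proof -
  have "su_part (mat 1 :: 'n spin_matrix) = 0"
    by (rule su_part_hermitian) (simp add: cadjoint_def mat_def vec_eq_iff)
  moreover have "su_part (mscale \<i> (mat 1) :: 'n spin_matrix) = 0"
    by transfer (auto simp: cadjoint_def mscale_def mat_def vec_eq_iff trace_def scaleR_conv_of_real[where 'a=complex])
  ultimately have "state_form w (mat 1) = 1"
    by (simp add: state_form_def trace_I del: card_fun)
  then show ?thesis by (simp add: state_form_eq_trace)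
qed

text \<open>For Y in the Lie algebra iY is hermitian, which leaves only the imaginary term of
  \<open>state_form\<close>; hence the density matrix determines the form.\<close>

lemma blinfun_apply_eq_trace:
  "complex_of_real (blinfun_apply w Y) = inverse \<i> * trace (Rep_su Y ** density_matrix w)"
proof -
  have Y: "cadjoint (Rep_su Y) = - Rep_su Y" "trace (Rep_su Y) = 0"
    using Rep_su[of Y] by auto
  have "su_part (mscale \<i> (Rep_su Y)) = 0"
    by (rule su_part_hermitian) (simp add: cadjoint_mscale Y, simp add: mscale_def vec_eq_iff)
  then show ?thesis
    by (simp add: Y state_form_def su_part_Rep_su flip: state_form_eq_trace)
qed

section \<open>Rank-one projections and pure states\<close>

definition outer :: "complex^'i \<Rightarrow> complex^'i^'i" where
  "outer a = (\<chi> i j. a $ i * cnj (a $ j))"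

lemma trace_mult_outer: "trace (M ** outer a) = cinner (M *v a) a"
  by (simp add: trace_def matrix_matrix_mult_def outer_def cinner_def matrix_vector_mult_def
      sum_distrib_right mult.assoc)

lemma cadjoint_outer: "cadjoint (outer a) = outer a"
  by (simp add: cadjoint_def outer_def mult.commute)

lemma trace_outer: "trace (outer a) = of_real ((norm a)\<^sup>2)"
  unfolding trace_def outer_def norm_vec_def L2_set_def
  by (simp add: sum_nonneg complex_norm_square del: of_real_power)

lemma trace_cadjoint_mult_hermitian:
  assumes "cadjoint P = P"
  shows "trace (cadjoint M ** P) = cnj (trace (M ** P))"
proof -
  have "trace (cadjoint M ** P) = trace (cadjoint (M ** P))"
    unfolding cadjoint_mult assms by (rule trace_mul_sym)
  then show ?thesis by (simp only: trace_cadjoint)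
qed

text \<open>Hermitian symmetry turns each product D_ij D_ji in the trace into |D_ij|^2, and the norm
  is the Euclidean norm of the entries.\<close>

lemma hermitian_trace_square:
  assumes "cadjoint D = D"
  shows "trace (D ** D) = of_real ((norm D)\<^sup>2)"
proof -
  have "D $ j $ i = cnj (D $ i $ j)" for i j
    using arg_cong[OF assms, of "\<lambda>A. A $ j $ i"] by (simp add: cadjoint_def)
  then have "D $ i $ j * D $ j $ i = of_real ((cmod (D $ i $ j))\<^sup>2)" for i j
    by (metis complex_norm_square)
  then have "trace (D ** D) = (\<Sum>i\<in>UNIV. \<Sum>j\<in>UNIV. of_real ((cmod (D $ i $ j))\<^sup>2))"
    by (simp add: trace_def matrix_matrix_mult_def)
  also have "\<dots> = of_real ((norm D)\<^sup>2)"
    by (simp add: norm_vec_def L2_set_def sum_nonneg)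
  finally show ?thesis .
qed

lemma outer_idempotent:
  assumes "norm a = 1"
  shows "outer a ** outer a = outer a"
proof -
  have "(\<Sum>k\<in>UNIV. a $ k * cnj (a $ k)) = 1"
    using trace_outer[of a] assms by (simp add: trace_def outer_def)
  moreover have "(outer a ** outer a) $ i $ j = (\<Sum>k\<in>UNIV. a $ k * cnj (a $ k)) * outer a $ i $ j" for i j
    by (simp add: matrix_matrix_mult_def outer_def sum_distrib_left sum_distrib_right mult_ac)
  ultimately show ?thesis by (simp add: vec_eq_iff)
qed

text \<open>Trace 1 forces a nonzero diagonal entry, and its column is fixed by P since P P = P.
  With \<open>a\<close> that column normalised, P minus \<open>outer a\<close> is again a hermitian
  idempotent, now of trace 0; the trace of its square is its squared norm, so it vanishes.\<close>

lemma hermitian_projection_trace_1: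
  assumes adj: "cadjoint P = P" and idem: "P ** P = P" and tr: "trace P = 1"
  shows "\<exists>a. norm a = 1 \<and> P = outer a"
proof -
  obtain r where r: "P $ r $ r \<noteq> 0"
  proof (rule ccontr)
    assume "\<not> thesis"
    then have "P $ r $ r = 0" for r using that by blast
    then show False using tr by (simp add: trace_def)
  qed
  define v where "v = (\<chi> i. P $ i $ r)"
  have "(P *v v) $ i = (P ** P) $ i $ r" for i
    by (simp add: v_def matrix_vector_mult_def matrix_matrix_mult_def)
  then have Pv: "P *v v = v"
    unfolding idem by (simp add: v_def vec_eq_iff)
  have "v \<noteq> 0" using r by (auto simp: v_def vec_eq_iff)
  define a where "a = (1 / norm v) *\<^sub>R v"
  have na: "norm a = 1" using \<open>v \<noteq> 0\<close> by (simp add: a_def)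
  have "P *v (c *\<^sub>R v) = c *\<^sub>R (P *v v)" for c
    by (simp add: vec_eq_iff matrix_vector_mult_def scaleR_sum_right)
  then have Pa: "P *v a = a" by (simp add: Pv a_def)
  have "(P ** outer a) $ i $ j = (P *v a) $ i * cnj (a $ j)" for i j
    by (simp add: matrix_matrix_mult_def matrix_vector_mult_def outer_def mult.assoc sum_distrib_right)
  then have PO: "P ** outer a = outer a"
    unfolding Pa by (simp add: vec_eq_iff outer_def)
  have OP: "outer a ** P = outer a"
    using arg_cong[OF PO, of cadjoint] by (simp add: cadjoint_mult adj cadjoint_outer)
  note OO = outer_idempotent[OF na]
  define Q where "Q = P - outer a"
  have QQ: "Q ** Q = Q"
    by (simp add: Q_def matrix_diff_ldistrib matrix_diff_rdistrib idem PO OP OO)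
  have "cadjoint Q = Q" by (simp add: Q_def cadjoint_diff adj cadjoint_outer)
  moreover have "trace Q = 0" by (simp add: Q_def trace_sub tr trace_outer na)
  ultimately have "norm Q = 0"
    using hermitian_trace_square[of Q] QQ by simp
  then show ?thesis using na by (auto simp: Q_def)
qed

text \<open>A pure state is given only by its values on the Lie algebra. They determine the trace
  pairing with \<open>outer a\<close> up to a multiple of the trace of M, and that multiple is fixed
  because \<open>outer a\<close> has trace 1.\<close>

lemma pure_state_iff_outer:
  "w \<in> pure_states \<longleftrightarrow> (\<exists>a. norm a = 1 \<and> density_matrix w = outer a)"
proof
  assume "\<exists>a. norm a = 1 \<and> density_matrix w = outer a"
  then show "w \<in> pure_states"
    by (auto simp: pure_states_def blinfun_apply_eq_trace trace_mult_outer)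
next
  assume "w \<in> pure_states"
  then obtain a where a: "norm a = 1"
    and w: "\<And>Y. complex_of_real (blinfun_apply w Y) = inverse \<i> * trace (Rep_su Y ** outer a)"
    by (auto simp: pure_states_def trace_mult_outer)
  let ?O = "outer a" and ?d = "of_nat CARD('a \<Rightarrow> 2) :: complex"
  have tO: "trace ?O = 1" by (simp add: trace_outer a)
  \<comment> \<open>Pairing the antihermitian part of M with a hermitian matrix gives i times the
    imaginary part of the pairing with M; the factor \<open>inverse \<i>\<close> in the definition
    of \<pi>_a removes the i.\<close>
  have w_Im: "blinfun_apply w (su_part M) = Im (trace (M ** ?O) - trace M / ?d)" for M
  proof -
    let ?K = "(1/2::real) *\<^sub>R (M - cadjoint M)"
    have "trace (Rep_su (su_part M) ** ?O) = trace (?K ** ?O) - trace (mat (trace ?K / ?d) ** ?O)"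
      by (simp add: su_part.rep_eq matrix_diff_rdistrib trace_sub del: card_fun)
    also have "trace (mat (trace ?K / ?d) ** ?O) = trace ?K / ?d"
    proof -
      have "mat c ** ?O = mscale c ?O" for c
        by (simp add: vec_eq_iff matrix_matrix_mult_def mat_def mscale_def if_distrib if_distribR cong: if_cong)
      then show ?thesis by (simp add: trace_mscale tO)
    qed
    also have "trace (?K ** ?O) = (trace (M ** ?O) - cnj (trace (M ** ?O))) / 2"
    proof -
      show ?thesis
        by (simp add: matrix_scaleR_left matrix_diff_rdistrib)
          (simp add: trace_scaleR trace_sub trace_cadjoint_mult_hermitian cadjoint_outer scaleR_conv_of_real[where 'a=complex])
    qed
    also have "trace ?K = (trace M - cnj (trace M)) / 2"
      by (simp add: trace_scaleR trace_sub trace_cadjoint scaleR_conv_of_real[where 'a=complex])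
    finally have "complex_of_real (blinfun_apply w (su_part M)) = inverse \<i> *
       ((trace (M ** ?O) - cnj (trace (M ** ?O))) / 2 - (trace M - cnj (trace M)) / 2 / ?d)"
      by (simp add: w del: card_fun)
    then have "blinfun_apply w (su_part M) = Re (inverse \<i> *
       ((trace (M ** ?O) - cnj (trace (M ** ?O))) / 2 - (trace M - cnj (trace M)) / 2 / ?d))"
      by (metis Re_complex_of_real)
    also have "\<dots> = Im (trace (M ** ?O) - trace M / ?d)"
      by (simp add: Im_divide_of_nat del: card_fun)
    finally show ?thesis .
  qed
  \<comment> \<open>Applied to iM, \<open>w_Im\<close> gives the real part, so the two Lie algebra
    terms reassemble the trace pairing up to tr M / 2^N.\<close>
  have "state_form w M = trace (M ** ?O)" for M
  proof -
    have "mscale \<i> M ** ?O = mscale \<i> (M ** ?O)"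
      by (simp add: vec_eq_iff matrix_matrix_mult_def mscale_def sum_distrib_left mult.assoc)
    then show ?thesis
      by (simp add: state_form_def w_Im trace_mscale complex_eq_iff Im_divide_of_nat Re_divide_of_nat del: card_fun)
  qed
  then have "density_matrix w = ?O"
    by (simp add: density_matrix_def vec_eq_iff trace_unit_matrix_mult)
  with a show "\<exists>a. norm a = 1 \<and> density_matrix w = outer a" by blast
qed

section \<open>The spin equation as a matrix equation\<close>

lemma has_vector_derivative_vec:
  fixes f :: "real \<Rightarrow> 'a::real_normed_vector ^ 'i"
  assumes "\<And>i. ((\<lambda>s. f s $ i) has_vector_derivative f' $ i) (at t)"
  shows "(f has_vector_derivative f') (at t)"
  using assms unfolding has_vector_derivative_def has_derivative_within
  by (auto intro!: vec_tendstoI bounded_linear_scaleR_left)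

lemma bounded_bilinear_matrix_mult:
  "bounded_bilinear ((**) :: complex^'i^'j \<Rightarrow> complex^'k^'i \<Rightarrow> complex^'k^'j)"
  unfolding bilinear_conv_bounded_bilinear[symmetric] bilinear_def
  by (auto intro!: linearI simp: matrix_add_ldistrib matrix_add_rdistrib matrix_scaleR_left matrix_scaleR_right)

text \<open>The differential equation is given for values on the Lie algebra. As
  \<open>su_part\<close> intertwines the brackets, it extends to \<open>state_form\<close> on all
  matrices, and cyclicity of the trace moves the commutator from the observable to the density
  matrix.\<close>

lemma pure_states_preserved:
  fixes \<omega> :: "real \<Rightarrow> 'n::finite su_dual" and A :: "real \<Rightarrow> 'n su"
  assumes der: "\<And>Y t. ((\<lambda>s. blinfun_apply (\<omega> s) Y) has_real_derivative
                   blinfun_apply (\<omega> t) (su_bracket (A t) Y)) (at t)"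
    and init: "\<omega> 0 \<in> pure_states"
  shows "\<omega> t \<in> pure_states"
proof -
  define \<rho> where "\<rho> t = density_matrix (\<omega> t)" for t
  define a where "a t = Rep_su (A t)" for t
  have d_form: "((\<lambda>s. state_form (\<omega> s) M) has_vector_derivative state_form (\<omega> t) (a t ** M - M ** a t)) (at t)"
    for M t
  proof -
    have i: "mscale \<i> (a t ** M - M ** a t) = a t ** mscale \<i> M - mscale \<i> M ** a t"
      by (simp add: vec_eq_iff matrix_matrix_mult_def mscale_def sum_distrib_left algebra_simps)
    \<comment> \<open>The trace term of \<open>state_form\<close> is constant in time, and on the
      right it contributes 0 because a commutator is traceless.\<close>
    have "trace (a t ** M - M ** a t) = 0"
      using trace_mul_sym[of "a t" M] by (simp add: trace_sub)
    then have "state_form (\<omega> t) (a t ** M - M ** a t)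
        = of_real (blinfun_apply (\<omega> t) (su_bracket (A t) (su_part (mscale \<i> M))))
          + \<i> * of_real (blinfun_apply (\<omega> t) (su_bracket (A t) (su_part M)))"
      by (simp add: state_form_def i su_bracket_su_part flip: a_def)
    then show ?thesis
      unfolding state_form_def[of "\<omega> _" M]
      by (auto intro!: derivative_eq_intros has_vector_derivative_of_real der
          simp flip: has_real_derivative_iff_has_vector_derivative)
  qed
  have d_rho: "(\<rho> has_vector_derivative \<rho> t ** a t - a t ** \<rho> t) (at t)" for t
  proof (intro has_vector_derivative_vec)
    fix i j
    have "state_form (\<omega> t) (a t ** unit_matrix j i - unit_matrix j i ** a t)
      = trace (unit_matrix j i ** (\<rho> t ** a t - a t ** \<rho> t))"
      unfolding state_form_eq_trace matrix_diff_ldistrib matrix_diff_rdistrib trace_sub \<rho>_def[symmetric]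
      using trace_mul_sym[of "a t" "unit_matrix j i ** \<rho> t"] by (simp add: matrix_mul_assoc)
    also have "\<dots> = (\<rho> t ** a t - a t ** \<rho> t) $ i $ j"
      by (rule trace_unit_matrix_mult)
    finally show "((\<lambda>s. \<rho> s $ i $ j) has_vector_derivative (\<rho> t ** a t - a t ** \<rho> t) $ i $ j) (at t)"
      using d_form[of "unit_matrix j i" t] by (simp add: \<rho>_def density_matrix_def)
  qed
  define D where "D t = \<rho> t ** \<rho> t - \<rho> t" for t
  note mult_der = bounded_bilinear.has_vector_derivative[OF bounded_bilinear_matrix_mult]
  have d_D: "(D has_vector_derivative D t ** a t - a t ** D t) (at t)" for t
  proof -
    have "((\<lambda>t. \<rho> t ** \<rho> t - \<rho> t) has_vector_derivative
       (\<rho> t ** (\<rho> t ** a t - a t ** \<rho> t) + (\<rho> t ** a t - a t ** \<rho> t) ** \<rho> t)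
         - (\<rho> t ** a t - a t ** \<rho> t)) (at t)"
      by (intro has_vector_derivative_diff mult_der d_rho)
    moreover have "(\<rho> t ** (\<rho> t ** a t - a t ** \<rho> t) + (\<rho> t ** a t - a t ** \<rho> t) ** \<rho> t)
         - (\<rho> t ** a t - a t ** \<rho> t) = D t ** a t - a t ** D t"
      by (simp add: D_def matrix_diff_ldistrib matrix_diff_rdistrib matrix_mul_assoc)
    ultimately show ?thesis by (simp add: D_def[abs_def])
  qed
  have herm: "cadjoint (\<rho> t) = \<rho> t" for t by (simp add: \<rho>_def cadjoint_density_matrix)
  then have "cadjoint (D t) = D t" for t by (simp add: D_def cadjoint_diff cadjoint_mult)
  then have nD: "trace (D t ** D t) = of_real ((norm (D t))\<^sup>2)" for t by (rule hermitian_trace_square)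
  have lin: "bounded_linear (trace :: 'n spin_matrix \<Rightarrow> complex)"
    unfolding linear_conv_bounded_linear[symmetric]
    by (auto simp: linear_iff trace_add trace_scaleR)
  have "((\<lambda>t. trace (D t ** D t)) has_vector_derivative 0) (at t)" for t
  proof -
    have "((\<lambda>t. trace (D t ** D t)) has_vector_derivative
       trace (D t ** (D t ** a t - a t ** D t) + (D t ** a t - a t ** D t) ** D t)) (at t)"
      by (intro bounded_linear.has_vector_derivative[OF lin] mult_der d_D)
    \<comment> \<open>The terms D a D cancel; what remains is the commutator of D D with a.\<close>
    moreover have "trace (D t ** (D t ** a t - a t ** D t) + (D t ** a t - a t ** D t) ** D t) = 0"
      using trace_mul_sym[of "D t ** D t" "a t"]
      by (simp add: trace_add trace_sub matrix_diff_ldistrib matrix_diff_rdistrib matrix_mul_assoc)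
    ultimately show ?thesis by simp
  qed
  then have "\<exists>c. \<forall>t\<in>UNIV. trace (D t ** D t) = c"
    by (intro has_derivative_zero_constant) (auto simp: has_vector_derivative_def)
  then have "trace (D t ** D t) = trace (D 0 ** D 0)" by auto
  moreover have "D 0 = 0"
  proof -
    obtain v where "norm v = 1" and v: "\<rho> 0 = outer v"
      using init by (auto simp: pure_state_iff_outer \<rho>_def)
    then show ?thesis by (simp add: D_def outer_idempotent)
  qed
  ultimately have "norm (D t) = 0" using nD[of t] nD[of 0] by simp
  then have "\<rho> t ** \<rho> t = \<rho> t" by (simp add: D_def)
  from hermitian_projection_trace_1[OF herm this] show ?thesis
    by (auto simp: pure_state_iff_outer \<rho>_def trace_density_matrix)
qed

section \<open>Oscillatory integrals\<close>

text \<open>Each k lies in the ball of radius 1 + n, with n the integer part of |k|. The volume of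
  that ball grows like (1 + n)^3, so the exponent 5 leaves the summable series of inverse
  squares.\<close>

lemma integrable_if_decay:
  fixes f :: "real^3 \<Rightarrow> real"
  assumes [measurable]: "f \<in> borel_measurable lborel"
    and decay: "\<And>k. \<bar>f k\<bar> * (1 + norm k) ^ 5 \<le> C"
  shows "integrable lborel f"
proof (rule integrableI_bounded)
  have C: "0 \<le> C" using decay[of 0] by (rule order_trans[rotated]) simp
  let ?g = "\<lambda>(n::nat) k::real^3. ennreal (C / (1 + real n) ^ 5) * indicator (cball 0 (1 + real n)) k"
  have "(\<integral>\<^sup>+ k. ennreal (norm (f k)) \<partial>lborel) \<le> (\<integral>\<^sup>+ k. (\<Sum>n. ?g n k) \<partial>lborel)"
  proof (rule nn_integral_mono)
    fix k :: "real^3"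
    define n where "n = nat \<lfloor>norm k\<rfloor>"
    have n: "real n \<le> norm k" "norm k \<le> 1 + real n"
      by (auto simp: n_def) linarith
    have "\<bar>f k\<bar> \<le> C / (1 + norm k) ^ 5"
      using decay[of k] by (subst pos_le_divide_eq) (auto intro!: zero_less_power add_pos_nonneg)
    also have "\<dots> \<le> C / (1 + real n) ^ 5"
      using n C by (intro divide_left_mono power_mono mult_pos_pos zero_less_power) auto
    finally have "ennreal (norm (f k)) \<le> ?g n k"
      using n by (simp add: ennreal_leI)
    also have "\<dots> \<le> (\<Sum>n. ?g n k)"
    proof -
      have "sum (\<lambda>n. ?g n k) {n} \<le> (\<Sum>n. ?g n k)"
        by (rule sum_le_suminf) auto
      then show ?thesis
        by (simp only: sum.insert sum.empty finite.emptyI empty_iff not_False_eq_True add_0_right)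
    qed
    finally show "ennreal (norm (f k)) \<le> (\<Sum>n. ?g n k)" .
  qed
  also have "\<dots> = (\<Sum>n. \<integral>\<^sup>+ k. ?g n k \<partial>lborel)"
    by (intro nn_integral_suminf borel_measurable_times_ennreal borel_measurable_const
        borel_measurable_indicator) auto
  also have "\<dots> = (\<Sum>n. ennreal (C * unit_ball_vol 3 * inverse (real (Suc n) ^ 2)))"
  proof (intro suminf_cong)
    fix n
    have "(\<integral>\<^sup>+ k. ?g n k \<partial>lborel) = ennreal (C / (1 + real n) ^ 5) * ennreal (unit_ball_vol 3 * (1 + real n) ^ 3)"
      by (subst nn_integral_cmult_indicator) (auto simp: emeasure_cball)
    also have "\<dots> = ennreal (C / (1 + real n) ^ 5 * (unit_ball_vol 3 * (1 + real n) ^ 3))"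
      by (rule ennreal_mult[symmetric]) (auto simp: C)
    also have "C / (1 + real n) ^ 5 * (unit_ball_vol 3 * (1 + real n) ^ 3)
       = C * unit_ball_vol 3 * inverse (real (Suc n) ^ 2)"
    proof -
      have "C / y ^ 5 * (V * y ^ 3) = C * V * inverse (y\<^sup>2)" if "0 < y" for y V :: real
        using that by (simp add: field_simps eval_nat_numeral)
      from this[of "1 + real n"] show ?thesis
        by (simp only: of_nat_Suc add_pos_nonneg zero_less_one of_nat_0_le_iff)
    qed
    finally show "(\<integral>\<^sup>+ k. ?g n k \<partial>lborel) = ennreal (C * unit_ball_vol 3 * inverse (real (Suc n) ^ 2))" .
  qed
  also have "\<dots> < \<infinity>"
  proof -
    have "summable (\<lambda>n. inverse (real (Suc n) ^ 2))"
      using inverse_power_summable[of 2, where 'a=real] by (subst summable_Suc_iff) auto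
    then have "summable (\<lambda>n. C * unit_ball_vol 3 * inverse (real (Suc n) ^ 2))"
      by (rule summable_mult)
    then show ?thesis
      by (subst suminf_ennreal2) (auto simp: C)
  qed
  finally show "(\<integral>\<^sup>+ k. ennreal (norm (f k)) \<partial>lborel) < \<infinity>" .
qed simp

lemma schwartz_continuous: "schwartz chi \<Longrightarrow> continuous_on UNIV chi"
  unfolding schwartz_def
  by (metis (mono_tags) funpow_0 continuous_at_imp_continuous_on differentiable_imp_continuous_within)

text \<open>Comparing 1 + r with 2 or with 2 r gives (1 + r)^n \<le> 2^n (1 + r^n), which reduces
  the claim to the Schwartz bounds on the zeroth derivative for the powers 0 and n.\<close>

lemma schwartz_decay:
  assumes "schwartz chi"
  obtains C where "\<And>r. 0 \<le> r \<Longrightarrow> (1 + r) ^ n * \<bar>chi r\<bar> \<le> C"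
proof -
  have "\<exists>C. \<forall>r. \<bar>r\<bar> ^ j * \<bar>chi r\<bar> \<le> C" for j
    using assms unfolding schwartz_def by (metis (mono_tags) funpow_0)
  then obtain C where C: "\<And>j r. \<bar>r\<bar> ^ j * \<bar>chi r\<bar> \<le> C j" by metis
  have "(1 + r) ^ n * \<bar>chi r\<bar> \<le> 2 ^ n * (C 0 + C n)" if "0 \<le> r" for r
  proof -
    have "(1 + r) ^ n \<le> 2 ^ n * (1 + r ^ n)"
    proof (cases "r \<le> 1")
      case True
      then have "(1 + r) ^ n \<le> 2 ^ n" using that by (intro power_mono) auto
      then show ?thesis using that by (smt (verit) zero_le_power mult_le_cancel_left1 zero_less_power)
    next
      case False
      then have "(1 + r) ^ n \<le> (2 * r) ^ n" using that by (intro power_mono) auto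
      then show ?thesis by (simp add: power_mult_distrib algebra_simps add_increasing)
    qed
    then have "(1 + r) ^ n * \<bar>chi r\<bar> \<le> 2 ^ n * (1 + r ^ n) * \<bar>chi r\<bar>"
      by (intro mult_right_mono) auto
    also have "\<dots> = 2 ^ n * (\<bar>chi r\<bar> + r ^ n * \<bar>chi r\<bar>)"
      by (simp add: algebra_simps)
    also have "\<dots> \<le> 2 ^ n * (C 0 + C n)"
      using C[of r 0] C[of r n] that by (intro mult_left_mono add_mono) auto
    finally show ?thesis .
  qed
  then show thesis by (rule that)
qed

text \<open>One factor of \<chi> pays for the moment and for the weight (1 + |k|)^5; the other is
  merely bounded.\<close>

lemma integrable_chi_moment:
  assumes "schwartz chi"
  shows "integrable lborel (\<lambda>k::real^3. norm k ^ n * (chi (norm k))\<^sup>2)"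
proof -
  obtain C0 where C0: "\<And>r. 0 \<le> r \<Longrightarrow> (1 + r) ^ 0 * \<bar>chi r\<bar> \<le> C0"
    using schwartz_decay[OF assms, where n = 0] by blast
  obtain C where C: "\<And>r. 0 \<le> r \<Longrightarrow> (1 + r) ^ (n + 5) * \<bar>chi r\<bar> \<le> C"
    using schwartz_decay[OF assms, where n = "n + 5"] by blast
  have "continuous_on UNIV (\<lambda>k::real^3. norm k ^ n * (chi (norm k))\<^sup>2)"
    by (intro continuous_intros continuous_on_compose2[OF schwartz_continuous[OF assms]]) auto
  then have "(\<lambda>k::real^3. norm k ^ n * (chi (norm k))\<^sup>2) \<in> borel_measurable lborel"
    by (simp add: borel_measurable_continuous_onI)
  moreover have "\<bar>norm k ^ n * (chi (norm k))\<^sup>2\<bar> * (1 + norm k) ^ 5 \<le> C * C0" for k :: "real^3"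
  proof -
    have "norm k ^ n \<le> (1 + norm k) ^ n" by (intro power_mono) auto
    then have "\<bar>norm k ^ n * (chi (norm k))\<^sup>2\<bar> * (1 + norm k) ^ 5
        \<le> (1 + norm k) ^ n * (chi (norm k))\<^sup>2 * (1 + norm k) ^ 5"
      by (auto simp: abs_mult intro!: mult_right_mono)
    also have "\<dots> = ((1 + norm k) ^ (n + 5) * \<bar>chi (norm k)\<bar>) * \<bar>chi (norm k)\<bar>"
      by (simp add: power_add power2_eq_square mult_ac flip: abs_mult)
    also have "\<dots> \<le> C * C0"
      using C[of "norm k"] C0[of "norm k"] order_trans[OF _ C[of 0]] by (intro mult_mono) auto
    finally show ?thesis .
  qed
  ultimately show ?thesis by (rule integrable_if_decay)
qed

text \<open>By the addition formulas both remainders reduce to those of sin and cos at 0, each at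
  most d^2/2. The bound holds for every d, so it can be inserted with d = k . v under an integral
  over all k, or with d replaced by d |k| in the flow.\<close>

lemma sin_Taylor1: "\<bar>sin (a + d) - sin a - d * cos a\<bar> \<le> d\<^sup>2"
  and cos_Taylor1: "\<bar>cos (a + d) - cos a + d * sin a\<bar> \<le> (d::real)\<^sup>2"
proof -
  have s: "\<bar>sin d - d\<bar> \<le> d\<^sup>2 / 2"
    using Maclaurin_sin_bound[of d 2] by (simp add: numeral_2_eq_2 sin_coeff_def field_simps)
  have "1 - cos d = 2 * (sin (d / 2))\<^sup>2"
    using cos_double_sin[of "d / 2"] by simp
  moreover have "(sin (d / 2))\<^sup>2 \<le> (d / 2)\<^sup>2"
    using abs_sin_x_le_abs_x[of "d / 2"] abs_le_square_iff by blast
  ultimately have c: "\<bar>cos d - 1\<bar> \<le> d\<^sup>2 / 2" by (simp add: power_divide)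
  have b: "\<bar>u * x + v * y\<bar> \<le> d\<^sup>2"
    if "\<bar>u\<bar> \<le> 1" "\<bar>v\<bar> \<le> 1" "\<bar>x\<bar> \<le> d\<^sup>2 / 2" "\<bar>y\<bar> \<le> d\<^sup>2 / 2" for u v x y :: real
  proof -
    have "\<bar>u * x\<bar> \<le> 1 * (d\<^sup>2 / 2)" "\<bar>v * y\<bar> \<le> 1 * (d\<^sup>2 / 2)"
      unfolding abs_mult using that by (intro mult_mono; simp)+
    then show ?thesis by linarith
  qed
  have "sin (a + d) - sin a - d * cos a = sin a * (cos d - 1) + cos a * (sin d - d)"
    by (simp add: sin_add algebra_simps)
  then show "\<bar>sin (a + d) - sin a - d * cos a\<bar> \<le> d\<^sup>2"
    using b[of "sin a" "cos a"] s c by simp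
  have "cos (a + d) - cos a + d * sin a = cos a * (cos d - 1) + (- sin a) * (sin d - d)"
    by (simp add: cos_add algebra_simps)
  then show "\<bar>cos (a + d) - cos a + d * sin a\<bar> \<le> d\<^sup>2"
    using b[of "cos a" "- sin a"] s c by (simp only: abs_minus_cancel abs_sin_le_one abs_cos_le_one)
qed

text \<open>Serves both the scalar integrals depending on x and the curves t \<mapsto> cos (t M) f
  in H, in place of dominated convergence.\<close>

lemma has_derivative_if_quadratic_remainder:
  assumes "bounded_linear L"
    and "\<And>v. norm (f (x + v) - f x - L v) \<le> C * (norm v)\<^sup>2"
  shows "(f has_derivative L) (at x)"
proof (rule has_derivativeI_sandwich[of 1])
  show "norm ((f y - f x) - L (y - x)) / norm (y - x) \<le> C * norm (y - x)" if "y \<noteq> x" for y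
    using assms(2)[of "y - x"] that by (simp add: divide_le_eq power2_eq_square mult.assoc)
  have "((\<lambda>y. C * norm (y - x)) \<longlongrightarrow> C * norm (x - x)) (at x)"
    by (intro tendsto_intros)
  then show "((\<lambda>y. C * norm (y - x)) \<longlongrightarrow> 0) (at x)" by simp
qed (auto simp: assms)

text \<open>First moments dominate the integrand. The lemma is also the source of integrability for
  the partial derivatives of \<open>B_form\<close> and of \<open>rho\<close>.\<close>

lemma integrable_oscillatory_derivative:
  fixes \<alpha> \<gamma> :: "real^3 \<Rightarrow> real"
  assumes \<alpha>: "\<And>n. integrable lborel (\<lambda>k. norm k ^ n * \<alpha> k)"
    and \<gamma>: "\<And>n. integrable lborel (\<lambda>k. norm k ^ n * \<gamma> k)"
  shows "integrable lborel (\<lambda>k. (k \<bullet> v) * (cos (k \<bullet> x) * \<alpha> k - sin (k \<bullet> x) * \<gamma> k))"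
proof -
  have m: "\<alpha> \<in> borel_measurable lborel" "\<gamma> \<in> borel_measurable lborel"
    using \<alpha>[of 0] \<gamma>[of 0] by (simp_all add: borel_measurable_integrable)
  note [measurable] = m[simplified]
  have distr: "x * y * (a + b) = y * (x * a + x * b)" for x y a b :: real
    by (simp add: algebra_simps)
  have nw: "\<bar>norm k ^ j * z\<bar> = norm k ^ j * \<bar>z\<bar>" for k :: "real^3" and j and z :: real
    by (simp only: abs_mult power_abs abs_norm_cancel)
  show ?thesis
  proof (rule Bochner_Integration.integrable_bound)
    show "integrable lborel (\<lambda>k. norm v * (\<bar>norm k ^ 1 * \<alpha> k\<bar> + \<bar>norm k ^ 1 * \<gamma> k\<bar>))"
      using \<alpha>[of 1] \<gamma>[of 1] by (intro integrable_mult_right Bochner_Integration.integrable_add integrable_abs) auto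
    show "AE k in lborel. norm ((k \<bullet> v) * (cos (k \<bullet> x) * \<alpha> k - sin (k \<bullet> x) * \<gamma> k))
        \<le> norm (norm v * (\<bar>norm k ^ 1 * \<alpha> k\<bar> + \<bar>norm k ^ 1 * \<gamma> k\<bar>))"
    proof (intro always_eventually allI)
      fix k
      have "\<bar>cos (k \<bullet> x) * \<alpha> k\<bar> \<le> 1 * \<bar>\<alpha> k\<bar>" "\<bar>sin (k \<bullet> x) * \<gamma> k\<bar> \<le> 1 * \<bar>\<gamma> k\<bar>"
        unfolding abs_mult by (intro mult_right_mono; simp)+
      then have "\<bar>cos (k \<bullet> x) * \<alpha> k - sin (k \<bullet> x) * \<gamma> k\<bar> \<le> \<bar>\<alpha> k\<bar> + \<bar>\<gamma> k\<bar>" by linarith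
      then have "\<bar>k \<bullet> v\<bar> * \<bar>cos (k \<bullet> x) * \<alpha> k - sin (k \<bullet> x) * \<gamma> k\<bar> \<le> (norm k * norm v) * (\<bar>\<alpha> k\<bar> + \<bar>\<gamma> k\<bar>)"
        by (intro mult_mono Cauchy_Schwarz_ineq2) auto
      also have "(norm k * norm v) * (\<bar>\<alpha> k\<bar> + \<bar>\<gamma> k\<bar>)
          = norm v * (\<bar>norm k ^ 1 * \<alpha> k\<bar> + \<bar>norm k ^ 1 * \<gamma> k\<bar>)"
        unfolding nw unfolding power_one_right by (rule distr)
      finally show "norm ((k \<bullet> v) * (cos (k \<bullet> x) * \<alpha> k - sin (k \<bullet> x) * \<gamma> k))
        \<le> norm (norm v * (\<bar>norm k ^ 1 * \<alpha> k\<bar> + \<bar>norm k ^ 1 * \<gamma> k\<bar>))"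
        unfolding real_norm_def abs_mult[of "k \<bullet> v"] by (rule order_trans[OF _ abs_ge_self])
    qed
  qed measurable
qed

text \<open>Expanding sine and cosine at k . x leaves a remainder of at most |k|^2 |v|^2 times the
  absolute amplitudes, and its integral is finite by the second moments.\<close>

lemma has_derivative_oscillatory_integral:
  fixes \<alpha> \<gamma> :: "real^3 \<Rightarrow> real"
  assumes \<alpha>: "\<And>n. integrable lborel (\<lambda>k. norm k ^ n * \<alpha> k)"
    and \<gamma>: "\<And>n. integrable lborel (\<lambda>k. norm k ^ n * \<gamma> k)"
  shows "((\<lambda>x. \<integral>k. sin (k \<bullet> x) * \<alpha> k + cos (k \<bullet> x) * \<gamma> k \<partial>lborel) has_derivative
     (\<lambda>v. \<integral>k. (k \<bullet> v) * (cos (k \<bullet> x) * \<alpha> k - sin (k \<bullet> x) * \<gamma> k) \<partial>lborel)) (at x)"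
proof -
  have m: "\<alpha> \<in> borel_measurable lborel" "\<gamma> \<in> borel_measurable lborel"
    using \<alpha>[of 0] \<gamma>[of 0] by (simp_all add: borel_measurable_integrable)
  note [measurable] = m[simplified]
  have rem: "(S * a + C * b) - (s * a + c * b) - d * (c * a - s * b) = (S - s - d * c) * a + (C - c + d * s) * b"
    for S C s c d a b :: real
    by (simp add: algebra_simps)
  have distr: "x * y * a + x * y * b = (x * a + x * b) * y" for x y a b :: real
    by (simp add: algebra_simps)
  have nw: "\<bar>norm k ^ j * z\<bar> = norm k ^ j * \<bar>z\<bar>" for k :: "real^3" and j and z :: real
    by (simp only: abs_mult power_abs abs_norm_cancel)
  have i0: "integrable lborel (\<lambda>k. sin (k \<bullet> y) * \<alpha> k + cos (k \<bullet> y) * \<gamma> k)" for y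
  proof (rule Bochner_Integration.integrable_bound)
    show "integrable lborel (\<lambda>k. \<bar>\<alpha> k\<bar> + \<bar>\<gamma> k\<bar>)"
      using \<alpha>[of 0] \<gamma>[of 0] by simp
    show "AE k in lborel. norm (sin (k \<bullet> y) * \<alpha> k + cos (k \<bullet> y) * \<gamma> k) \<le> norm (\<bar>\<alpha> k\<bar> + \<bar>\<gamma> k\<bar>)"
    proof (intro always_eventually allI)
      fix k
      have "\<bar>sin (k \<bullet> y) * \<alpha> k\<bar> \<le> 1 * \<bar>\<alpha> k\<bar>" "\<bar>cos (k \<bullet> y) * \<gamma> k\<bar> \<le> 1 * \<bar>\<gamma> k\<bar>"
        unfolding abs_mult by (intro mult_right_mono; simp)+
      then show "norm (sin (k \<bullet> y) * \<alpha> k + cos (k \<bullet> y) * \<gamma> k) \<le> norm (\<bar>\<alpha> k\<bar> + \<bar>\<gamma> k\<bar>)"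
        by simp
    qed
  qed measurable
  note i1 = integrable_oscillatory_derivative[OF \<alpha> \<gamma>]
  let ?L = "\<lambda>v. \<integral>k. (k \<bullet> v) * (cos (k \<bullet> x) * \<alpha> k - sin (k \<bullet> x) * \<gamma> k) \<partial>lborel"
  have "linear ?L"
  proof (rule linearI)
    show "?L (v + w) = ?L v + ?L w" for v w
      by (subst Bochner_Integration.integral_add[symmetric, OF i1 i1]) (simp add: inner_add_right algebra_simps)
    show "?L (c *\<^sub>R v) = c *\<^sub>R ?L v" for c v
      by (simp add: mult.assoc)
  qed
  then have L: "bounded_linear ?L" by (simp add: linear_conv_bounded_linear)
  let ?C = "\<integral>k. \<bar>norm k ^ 2 * \<alpha> k\<bar> + \<bar>norm k ^ 2 * \<gamma> k\<bar> \<partial>lborel"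
  have iC: "integrable lborel (\<lambda>k. \<bar>norm k ^ 2 * \<alpha> k\<bar> + \<bar>norm k ^ 2 * \<gamma> k\<bar>)"
    using \<alpha>[of 2] \<gamma>[of 2] by auto
  show ?thesis
  proof (rule has_derivative_if_quadratic_remainder[OF L, of _ _ ?C])
    fix v
    let ?r = "\<lambda>k. (sin (k \<bullet> (x + v)) * \<alpha> k + cos (k \<bullet> (x + v)) * \<gamma> k)
       - (sin (k \<bullet> x) * \<alpha> k + cos (k \<bullet> x) * \<gamma> k)
       - (k \<bullet> v) * (cos (k \<bullet> x) * \<alpha> k - sin (k \<bullet> x) * \<gamma> k)"
    have r: "integrable lborel ?r"
      by (intro Bochner_Integration.integrable_diff i0 i1)
    have "norm (integral\<^sup>L lborel ?r) \<le> (\<integral>k. norm (?r k) \<partial>lborel)"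
      by (rule integral_norm_bound)
    also have "\<dots> \<le> (\<integral>k. (\<bar>norm k ^ 2 * \<alpha> k\<bar> + \<bar>norm k ^ 2 * \<gamma> k\<bar>) * (norm v)\<^sup>2 \<partial>lborel)"
    proof (rule integral_mono)
      show "integrable lborel (\<lambda>k. norm (?r k))" using r by (rule integrable_norm)
      show "integrable lborel (\<lambda>k. (\<bar>norm k ^ 2 * \<alpha> k\<bar> + \<bar>norm k ^ 2 * \<gamma> k\<bar>) * (norm v)\<^sup>2)"
        using iC by simp
      fix k
      let ?a = "k \<bullet> x" and ?d = "k \<bullet> v"
      have "\<bar>?d\<bar>\<^sup>2 \<le> (norm k * norm v)\<^sup>2"
        by (intro power_mono Cauchy_Schwarz_ineq2) auto
      then have d: "?d\<^sup>2 \<le> (norm k)\<^sup>2 * (norm v)\<^sup>2" by (simp add: power_mult_distrib)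
      have "?r k = (sin (?a + ?d) - sin ?a - ?d * cos ?a) * \<alpha> k + (cos (?a + ?d) - cos ?a + ?d * sin ?a) * \<gamma> k"
        unfolding inner_add_right by (rule rem)
      then have "\<bar>?r k\<bar> \<le> \<bar>sin (?a + ?d) - sin ?a - ?d * cos ?a\<bar> * \<bar>\<alpha> k\<bar> + \<bar>cos (?a + ?d) - cos ?a + ?d * sin ?a\<bar> * \<bar>\<gamma> k\<bar>"
        by (simp only: abs_triangle_ineq flip: abs_mult)
      also have "\<dots> \<le> (norm k)\<^sup>2 * (norm v)\<^sup>2 * \<bar>\<alpha> k\<bar> + (norm k)\<^sup>2 * (norm v)\<^sup>2 * \<bar>\<gamma> k\<bar>"
        by (intro add_mono mult_right_mono order_trans[OF sin_Taylor1 d] order_trans[OF cos_Taylor1 d] abs_ge_zero)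
      also have "\<dots> = (\<bar>norm k ^ 2 * \<alpha> k\<bar> + \<bar>norm k ^ 2 * \<gamma> k\<bar>) * (norm v)\<^sup>2"
        unfolding nw by (rule distr)
      finally show "norm (?r k) \<le> (\<bar>norm k ^ 2 * \<alpha> k\<bar> + \<bar>norm k ^ 2 * \<gamma> k\<bar>) * (norm v)\<^sup>2"
        unfolding real_norm_def .
    qed
    also have "\<dots> = ?C * (norm v)\<^sup>2" by simp
    finally show "norm ((\<integral>k. sin (k \<bullet> (x + v)) * \<alpha> k + cos (k \<bullet> (x + v)) * \<gamma> k \<partial>lborel)
       - (\<integral>k. sin (k \<bullet> x) * \<alpha> k + cos (k \<bullet> x) * \<gamma> k \<partial>lborel) - ?L v) \<le> ?C * (norm v)\<^sup>2"
      unfolding Bochner_Integration.integral_diff[OF Bochner_Integration.integrable_diff[OF i0 i0] i1]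
        Bochner_Integration.integral_diff[OF i0 i0] .
  qed
qed

text \<open>\<open>deriv\<close> is a choice operator whose value is known only once a derivative
  exists; a total derivative provides one along every axis.\<close>

lemma partial_deriv_eq:
  assumes "(f has_derivative L) (at x)"
  shows "partial_deriv j f x = L (axis j 1)"
proof -
  have "((\<lambda>s. x + s *\<^sub>R axis j 1) has_derivative (\<lambda>s. s *\<^sub>R axis j 1)) (at 0)"
    by (auto intro!: derivative_eq_intros)
  from has_derivative_compose[OF this, of f L] assms
  have "((\<lambda>s. f (x + s *\<^sub>R axis j 1)) has_derivative (\<lambda>s. L (s *\<^sub>R axis j 1))) (at 0)"
    by simp
  moreover have "L (s *\<^sub>R axis j 1) = L (axis j 1) * s" for s
    using linear_scale[OF has_derivative_linear[OF assms]] by simp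
  ultimately have "((\<lambda>s. f (x + s *\<^sub>R axis j 1)) has_real_derivative L (axis j 1)) (at 0)"
    by (simp add: has_field_derivative_def)
  then show ?thesis unfolding partial_deriv_def by (rule DERIV_imp_deriv)
qed

section \<open>The free evolution\<close>

lemma L2_eq_refl: "transversal_L2 f \<Longrightarrow> L2_eq f f"
  by (simp add: L2_eq_def)

text \<open>The quotient is partial: \<open>abs_transversal_field\<close> is meaningful only on
  functions satisfying \<open>transversal_L2\<close>, so a computation in H begins by naming such a
  representative.\<close>

lemma transversal_field_cases:
  obtains f where "transversal_L2 f" "q = abs_transversal_field f"
proof (rule that)
  show "q = abs_transversal_field (rep_transversal_field q)"
    by (simp add: Quotient3_abs_rep[OF Quotient3_transversal_field])
  show "transversal_L2 (rep_transversal_field q)"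
    using Quotient3_rep_reflp[OF Quotient3_transversal_field, of q] by (simp add: L2_eq_def)
qed

lemma abs_field_eqI:
  assumes "transversal_L2 f" "transversal_L2 g" "AE k in lborel. f k = g k"
  shows "abs_transversal_field f = abs_transversal_field g"
  using assms Quotient3_rel_abs[OF Quotient3_transversal_field, of f g] by (simp add: L2_eq_def)

lemma abs_field_simps:
  assumes "transversal_L2 f"
  shows "cos_mult t (abs_transversal_field f) = abs_transversal_field (\<lambda>k. cos (t * norm k) *\<^sub>R f k)"
    and "sin_mult t (abs_transversal_field f) = abs_transversal_field (\<lambda>k. sin (t * norm k) *\<^sub>R f k)"
    and "helicity (abs_transversal_field f) = abs_transversal_field (\<lambda>k. (1 / norm k) *\<^sub>R cross3 k (f k))"
    and "c *\<^sub>R abs_transversal_field f = abs_transversal_field (\<lambda>k. c *\<^sub>R f k)"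
    and "- abs_transversal_field f = abs_transversal_field (\<lambda>k. - f k)"
    and "transversal_L2 g \<Longrightarrow>
      abs_transversal_field f + abs_transversal_field g = abs_transversal_field (\<lambda>k. f k + g k)"
    and "transversal_L2 g \<Longrightarrow>
      abs_transversal_field f - abs_transversal_field g = abs_transversal_field (\<lambda>k. f k - g k)"
  using assms
  by (simp_all add: cos_mult.abs_eq sin_mult.abs_eq helicity.abs_eq scaleR_transversal_field.abs_eq
      uminus_transversal_field.abs_eq plus_transversal_field.abs_eq minus_transversal_field.abs_eq L2_eq_refl)

lemma transversal_L2_cos: "transversal_L2 f \<Longrightarrow> transversal_L2 (\<lambda>k. cos (t * norm k) *\<^sub>R f k)"
  by (rule transversal_L2_mult[where C = 1]) auto

lemma transversal_L2_sin: "transversal_L2 f \<Longrightarrow> transversal_L2 (\<lambda>k. sin (t * norm k) *\<^sub>R f k)"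
  by (rule transversal_L2_mult[where C = 1]) auto

lemma transversal_L2_uminus: "transversal_L2 f \<Longrightarrow> transversal_L2 (\<lambda>k. - f k)"
  using transversal_L2_scaleR[of f "-1"] by simp

lemma transversal_L2_diff: "transversal_L2 f \<Longrightarrow> transversal_L2 g \<Longrightarrow> transversal_L2 (\<lambda>k. f k - g k)"
  using transversal_L2_add[OF _ transversal_L2_uminus] by simp

lemmas transversal_L2_intros = transversal_L2_add transversal_L2_diff transversal_L2_uminus
  transversal_L2_scaleR transversal_L2_cos transversal_L2_sin transversal_L2_cross

lemma integrable_inner_L2:
  assumes "transversal_L2 f" "transversal_L2 g"
  shows "integrable lborel (\<lambda>k. f k \<bullet> g k)"
  unfolding inner_vec_def using transversal_L2_integrable_prod[OF assms] by simp

lemma inner_abs_field: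
  assumes "transversal_L2 f" "transversal_L2 g"
  shows "abs_transversal_field f \<bullet> abs_transversal_field g = (\<integral>k. f k \<bullet> g k \<partial>lborel)"
  unfolding inner_transversal_field.abs_eq[OF L2_eq_refl[OF assms(1)] L2_eq_refl[OF assms(2)]] inner_vec_def
  using transversal_L2_integrable_prod[OF assms] by (simp add: Bochner_Integration.integral_sum)

lemma norm_abs_field_le:
  assumes f: "transversal_L2 f" and g: "transversal_L2 g" and C: "0 \<le> C"
    and le: "\<And>k. norm (f k) \<le> C * norm (g k)"
  shows "norm (abs_transversal_field f) \<le> C * norm (abs_transversal_field g)"
proof -
  have "(\<integral>k. f k \<bullet> f k \<partial>lborel) \<le> (\<integral>k. C\<^sup>2 * (g k \<bullet> g k) \<partial>lborel)"
  proof (rule integral_mono)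
    show "integrable lborel (\<lambda>k. f k \<bullet> f k)" by (rule integrable_inner_L2[OF f f])
    show "integrable lborel (\<lambda>k. C\<^sup>2 * (g k \<bullet> g k))" using integrable_inner_L2[OF g g] by simp
    show "f k \<bullet> f k \<le> C\<^sup>2 * (g k \<bullet> g k)" for k
      using power_mono[OF le[of k], of 2] by (simp add: power_mult_distrib power2_norm_eq_inner)
  qed
  then have "(norm (abs_transversal_field f))\<^sup>2 \<le> (C * norm (abs_transversal_field g))\<^sup>2"
    by (simp add: power_mult_distrib power2_norm_eq_inner inner_abs_field f g)
  then show ?thesis by (rule power2_le_imp_le) (use C in simp)
qed

text \<open>Multiplication by cos (t |k|) or sin (t |k|) and the helicity all act at each k
  separately by a linear contraction, so the operator norm is at most 1.\<close>

lemma bounded_linear_fieldI: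
  assumes T: "\<And>f. transversal_L2 f \<Longrightarrow> T (abs_transversal_field f) = abs_transversal_field (\<lambda>k. m k (f k))"
    and m: "\<And>f. transversal_L2 f \<Longrightarrow> transversal_L2 (\<lambda>k. m k (f k))"
    and lin: "\<And>k. linear (m k)"
    and le: "\<And>k v. norm (m k v) \<le> norm v"
  shows "bounded_linear T"
proof (rule bounded_linear_intro[where K = 1])
  fix q p :: transversal_field and c :: real
  obtain f where f: "transversal_L2 f" "q = abs_transversal_field f" by (rule transversal_field_cases)
  obtain g where g: "transversal_L2 g" "p = abs_transversal_field g" by (rule transversal_field_cases)
  show "T (q + p) = T q + T p"
    using f g by (simp add: abs_field_simps T m transversal_L2_intros linear_add[OF lin])
  show "T (c *\<^sub>R q) = c *\<^sub>R T q"
    using f by (simp add: abs_field_simps T m transversal_L2_intros linear_scale[OF lin])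
  show "norm (T q) \<le> norm q * 1"
    using norm_abs_field_le[OF m[OF f(1)] f(1), of 1] le f by (simp add: T)
qed

lemma bounded_linear_cos_mult: "bounded_linear (cos_mult t)"
  by (rule bounded_linear_fieldI[where m = "\<lambda>k v. cos (t * norm k) *\<^sub>R v"])
    (auto simp: abs_field_simps transversal_L2_intros mult_left_le_one_le intro!: linearI scaleR_add_right)

lemma bounded_linear_sin_mult: "bounded_linear (sin_mult t)"
  by (rule bounded_linear_fieldI[where m = "\<lambda>k v. sin (t * norm k) *\<^sub>R v"])
    (auto simp: abs_field_simps transversal_L2_intros mult_left_le_one_le intro!: linearI scaleR_add_right)

lemma bounded_linear_helicity: "bounded_linear helicity"
proof (rule bounded_linear_fieldI[where m = "\<lambda>k v. (1 / norm k) *\<^sub>R cross3 k v"])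
  fix k v :: "real^3"
  have "(norm (cross3 k v))\<^sup>2 \<le> (norm k * norm v)\<^sup>2"
    using norm_cross_dot[of k v] zero_le_power2[of "k \<bullet> v"] by linarith
  then have "norm (cross3 k v) \<le> norm k * norm v" by (rule power2_le_imp_le) simp
  then show "norm ((1 / norm k) *\<^sub>R cross3 k v) \<le> norm v"
    by (cases "k = 0") (simp_all add: divide_le_eq mult.commute)
  show "linear (\<lambda>v. (1 / norm k) *\<^sub>R cross3 k v)"
    by (rule linearI) (simp_all add: cross_add_right cross_mult_right scaleR_add_right)
qed (auto simp: abs_field_simps transversal_L2_intros)

lemma cos_sin_mult_simps:
  "cos_mult s (cos_mult t q) - sin_mult s (sin_mult t q) = cos_mult (s + t) q"
  "sin_mult s (cos_mult t q) + cos_mult s (sin_mult t q) = sin_mult (s + t) q"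
  "cos_mult (- t) q = cos_mult t q" "sin_mult (- t) q = - sin_mult t q"
  "cos_mult 0 q = q" "sin_mult 0 q = 0"
  "helicity (cos_mult t q) = cos_mult t (helicity q)"
  "helicity (sin_mult t q) = sin_mult t (helicity q)"
  "cos_mult t q \<bullet> p = q \<bullet> cos_mult t p"
  "sin_mult t q \<bullet> p = q \<bullet> sin_mult t p"
proof -
  obtain f where f: "transversal_L2 f" "q = abs_transversal_field f" by (rule transversal_field_cases)
  obtain g where g: "transversal_L2 g" "p = abs_transversal_field g" by (rule transversal_field_cases)
  note s = abs_field_simps transversal_L2_intros f(1) g(1) inner_abs_field
  show "cos_mult s (cos_mult t q) - sin_mult s (sin_mult t q) = cos_mult (s + t) q"
    unfolding f(2) by (simp add: s del: scaleR_scaleR) (simp add: distrib_right cos_add scaleR_diff_left)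
  show "sin_mult s (cos_mult t q) + cos_mult s (sin_mult t q) = sin_mult (s + t) q"
    unfolding f(2) by (simp add: s del: scaleR_scaleR) (simp add: distrib_right sin_add scaleR_add_left)
  show "cos_mult (- t) q = cos_mult t q" "sin_mult (- t) q = - sin_mult t q" "cos_mult 0 q = q"
    "sin_mult 0 q = 0"
    unfolding f(2) by (simp_all add: s zero_transversal_field_def)
  show "helicity (cos_mult t q) = cos_mult t (helicity q)" "helicity (sin_mult t q) = sin_mult t (helicity q)"
    unfolding f(2) by (simp_all add: s cross_mult_right mult.commute)
  show "cos_mult t q \<bullet> p = q \<bullet> cos_mult t p" "sin_mult t q \<bullet> p = q \<bullet> sin_mult t p"
    unfolding f(2) g(2) by (simp_all add: s)
qed

lemma bounded_linear_free_evolution: "bounded_linear (free_evolution t)"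
  unfolding free_evolution_def
  by (intro bounded_linear_Pair bounded_linear_add bounded_linear_minus
      bounded_linear_compose[OF bounded_linear_cos_mult] bounded_linear_compose[OF bounded_linear_sin_mult]
      bounded_linear_fst bounded_linear_snd)

lemma bounded_linear_J_map: "bounded_linear J_map"
  unfolding J_map_def
  by (intro bounded_linear_Pair bounded_linear_compose[OF bounded_linear_helicity]
      bounded_linear_fst bounded_linear_snd)

lemma free_evolution_add: "free_evolution s (free_evolution t Z) = free_evolution (s + t) Z"
  unfolding free_evolution_def
  by (simp add: cos_sin_mult_simps(1,2)[symmetric]
      linear_add[OF bounded_linear.linear[OF bounded_linear_cos_mult]]
      linear_add[OF bounded_linear.linear[OF bounded_linear_sin_mult]]
      linear_neg[OF bounded_linear.linear[OF bounded_linear_cos_mult]]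
      linear_neg[OF bounded_linear.linear[OF bounded_linear_sin_mult]]
      linear_diff[OF bounded_linear.linear[OF bounded_linear_cos_mult]]
      linear_diff[OF bounded_linear.linear[OF bounded_linear_sin_mult]] algebra_simps)

lemma free_evolution_0: "free_evolution 0 Z = Z"
  by (simp add: free_evolution_def cos_sin_mult_simps)

text \<open>The helicity acts linearly at each k and so commutes with multiplication by functions of
  |k|.\<close>

lemma J_map_free_evolution: "J_map (free_evolution t Z) = free_evolution t (J_map Z)"
  by (simp add: J_map_def free_evolution_def cos_sin_mult_simps
      linear_add[OF bounded_linear.linear[OF bounded_linear_helicity]]
      linear_diff[OF bounded_linear.linear[OF bounded_linear_helicity]])

text \<open>Multiplication by cos (t |k|) and sin (t |k|) is symmetric and only the sine changes
  sign with t, so the adjoint of R_t is R_{-t}. This is also its inverse, which makes R_t an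
  isometry.\<close>

lemma inner_free_evolution: "W \<bullet> free_evolution t Z = free_evolution (- t) W \<bullet> Z"
  by (cases W; cases Z)
    (simp add: free_evolution_def cos_sin_mult_simps inner_add_left inner_add_right inner_diff_left inner_diff_right)

lemma norm_free_evolution: "norm (free_evolution t Z) = norm Z"
  by (simp add: norm_eq_sqrt_inner inner_free_evolution free_evolution_add free_evolution_0)

section \<open>Norm differentiability of the flow on fields with all moments\<close>

definition moments_L2 :: "(real^3 \<Rightarrow> real^3) \<Rightarrow> bool" where
  "moments_L2 f \<longleftrightarrow> (\<forall>n. transversal_L2 (\<lambda>k. norm k ^ n *\<^sub>R f k))"

lemma moments_L2_imp_L2: "moments_L2 f \<Longrightarrow> transversal_L2 f"
  unfolding moments_L2_def by (drule spec[of _ 0]) simp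

lemma moments_L2_norm_mult: "moments_L2 f \<Longrightarrow> moments_L2 (\<lambda>k. norm k *\<^sub>R f k)"
  unfolding moments_L2_def
proof
  fix n assume "\<forall>n. transversal_L2 (\<lambda>k. norm k ^ n *\<^sub>R f k)"
  then have "transversal_L2 (\<lambda>k. norm k ^ Suc n *\<^sub>R f k)" by blast
  then show "transversal_L2 (\<lambda>k. norm k ^ n *\<^sub>R norm k *\<^sub>R f k)" by (simp add: mult.commute)
qed

lemma moments_L2_uminus: "moments_L2 f \<Longrightarrow> moments_L2 (\<lambda>k. - f k)"
  unfolding moments_L2_def using transversal_L2_uminus by fastforce

text \<open>One argument for sine and cosine, with \<open>v\<close> in the role of the derivative of
  \<open>u\<close>. At each k the Taylor remainder is at most d^2 |k|^2 |f(k)|, and M^2 f lies in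
  H.\<close>

lemma has_vector_derivative_field_flow:
  fixes u v :: "real \<Rightarrow> real"
  assumes f: "moments_L2 f"
    and Taylor: "\<And>a d. \<bar>u (a + d) - u a - d * v a\<bar> \<le> d\<^sup>2"
    and L2: "\<And>t h. transversal_L2 h \<Longrightarrow> transversal_L2 (\<lambda>k. u (t * norm k) *\<^sub>R h k)"
      "\<And>t h. transversal_L2 h \<Longrightarrow> transversal_L2 (\<lambda>k. v (t * norm k) *\<^sub>R h k)"
  shows "((\<lambda>t. abs_transversal_field (\<lambda>k. u (t * norm k) *\<^sub>R f k)) has_vector_derivative
    abs_transversal_field (\<lambda>k. v (t * norm k) *\<^sub>R norm k *\<^sub>R f k)) (at t)"
  unfolding has_vector_derivative_def
proof (rule has_derivative_if_quadratic_remainder)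
  fix d
  have f0: "transversal_L2 f" and f1: "transversal_L2 (\<lambda>k. norm k *\<^sub>R f k)"
    and f2: "transversal_L2 (\<lambda>k. norm k ^ 2 *\<^sub>R f k)"
    using f moments_L2_imp_L2 moments_L2_norm_mult by (auto simp: moments_L2_def)
  note L = L2(1)[OF f0] L2(2)[OF f1] transversal_L2_intros
  let ?r = "\<lambda>k. u ((t + d) * norm k) *\<^sub>R f k - u (t * norm k) *\<^sub>R f k - d *\<^sub>R v (t * norm k) *\<^sub>R norm k *\<^sub>R f k"
  have "norm (abs_transversal_field ?r) \<le> d\<^sup>2 * norm (abs_transversal_field (\<lambda>k. norm k ^ 2 *\<^sub>R f k))"
  proof (rule norm_abs_field_le)
    show "transversal_L2 ?r" by (intro L)
    fix k
    have "?r k = (u (t * norm k + d * norm k) - u (t * norm k) - (d * norm k) * v (t * norm k)) *\<^sub>R f k"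
      unfolding distrib_right by (simp add: scaleR_diff_left mult_ac)
    then show "norm (?r k) \<le> d\<^sup>2 * norm (norm k ^ 2 *\<^sub>R f k)"
      using mult_right_mono[OF Taylor[of "t * norm k" "d * norm k"] norm_ge_zero[of "f k"]]
      by (simp add: power_mult_distrib mult.assoc)
  qed (auto simp: f2)
  moreover have "abs_transversal_field ?r = abs_transversal_field (\<lambda>k. u ((t + d) * norm k) *\<^sub>R f k)
     - abs_transversal_field (\<lambda>k. u (t * norm k) *\<^sub>R f k)
     - d *\<^sub>R abs_transversal_field (\<lambda>k. v (t * norm k) *\<^sub>R norm k *\<^sub>R f k)"
    by (simp add: abs_field_simps(4,7) L del: scaleR_scaleR)
  ultimately show "norm (abs_transversal_field (\<lambda>k. u ((t + d) * norm k) *\<^sub>R f k)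
     - abs_transversal_field (\<lambda>k. u (t * norm k) *\<^sub>R f k)
     - d *\<^sub>R abs_transversal_field (\<lambda>k. v (t * norm k) *\<^sub>R norm k *\<^sub>R f k))
     \<le> norm (abs_transversal_field (\<lambda>k. norm k ^ 2 *\<^sub>R f k)) * (norm d)\<^sup>2"
    by (simp add: mult.commute)
qed (rule bounded_linear_scaleR_left)

lemma has_vector_derivative_sin_mult:
  assumes "moments_L2 f"
  shows "((\<lambda>t. sin_mult t (abs_transversal_field f)) has_vector_derivative
     cos_mult t (abs_transversal_field (\<lambda>k. norm k *\<^sub>R f k))) (at t)"
  using has_vector_derivative_field_flow[OF assms sin_Taylor1 transversal_L2_sin transversal_L2_cos]
  by (simp add: abs_field_simps(1,2) moments_L2_imp_L2 assms moments_L2_norm_mult)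

lemma has_vector_derivative_cos_mult:
  assumes "moments_L2 f"
  shows "((\<lambda>t. cos_mult t (abs_transversal_field f)) has_vector_derivative
     - sin_mult t (abs_transversal_field (\<lambda>k. norm k *\<^sub>R f k))) (at t)"
proof -
  have "((\<lambda>t. abs_transversal_field (\<lambda>k. cos (t * norm k) *\<^sub>R f k)) has_vector_derivative
    abs_transversal_field (\<lambda>k. (- sin (t * norm k)) *\<^sub>R norm k *\<^sub>R f k)) (at t)"
  proof (rule has_vector_derivative_field_flow[OF assms, of cos "\<lambda>x. - sin x"])
    show "\<bar>cos (a + d) - cos a - d * (- sin a)\<bar> \<le> d\<^sup>2" for a d :: real
      using cos_Taylor1[of a d] by simp
    show "transversal_L2 (\<lambda>k. (- sin (t * norm k)) *\<^sub>R h k)" if "transversal_L2 h" for t h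
      using transversal_L2_uminus[OF transversal_L2_sin[OF that]] by simp
  qed (rule transversal_L2_cos)
  then show ?thesis
    by (simp add: abs_field_simps(1,2,5) moments_L2_imp_L2 assms moments_L2_norm_mult transversal_L2_sin
        del: scaleR_scaleR)
qed

lemma has_vector_derivative_free_evolution:
  assumes "moments_L2 f" "moments_L2 g"
  shows "((\<lambda>t. free_evolution t (abs_transversal_field f, abs_transversal_field g)) has_vector_derivative
     free_evolution t (abs_transversal_field (\<lambda>k. norm k *\<^sub>R g k),
       - abs_transversal_field (\<lambda>k. norm k *\<^sub>R f k))) (at t)"
proof -
  have "((\<lambda>t. free_evolution t (abs_transversal_field f, abs_transversal_field g)) has_vector_derivative
     (- sin_mult t (abs_transversal_field (\<lambda>k. norm k *\<^sub>R f k))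
        + cos_mult t (abs_transversal_field (\<lambda>k. norm k *\<^sub>R g k)),
      - cos_mult t (abs_transversal_field (\<lambda>k. norm k *\<^sub>R f k))
        + (- sin_mult t (abs_transversal_field (\<lambda>k. norm k *\<^sub>R g k))))) (at t)"
    unfolding free_evolution_def fst_conv snd_conv
    by (intro has_vector_derivative_Pair has_vector_derivative_add has_vector_derivative_minus
        has_vector_derivative_sin_mult has_vector_derivative_cos_mult assms)
  then show ?thesis
    by (simp add: free_evolution_def add.commute
      linear_neg[OF bounded_linear.linear[OF bounded_linear_cos_mult]]
      linear_neg[OF bounded_linear.linear[OF bounded_linear_sin_mult]])
qed

text \<open>Norm differentiability is asked of \<open>G\<close> alone. Expand G s into G t, (s - t)
  G' and a remainder: the pairing of G t with \<open>Y\<close> is differentiable by assumption, the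
  linear term needs continuity of G' . Y, and the remainder is o(s - t) against the locally bounded
  norm of \<open>Y\<close>.\<close>

lemma weak_product_rule:
  fixes G Y :: "real \<Rightarrow> 'a::real_inner"
  assumes G: "(G has_vector_derivative G') (at t)"
    and Y: "isCont (\<lambda>s. norm (Y s)) t"
    and d: "((\<lambda>s. G t \<bullet> Y s) has_real_derivative d) (at t)"
    and c: "isCont (\<lambda>s. G' \<bullet> Y s) t"
  shows "((\<lambda>s. G s \<bullet> Y s) has_real_derivative G' \<bullet> Y t + d) (at t)"
proof -
  define r where "r s = G s - G t - (s - t) *\<^sub>R G'" for s
  \<comment> \<open>By Caratheodory's criterion (s - t) \<phi>(s) has derivative \<phi>(t) at t as
    soon as \<phi> is continuous there.\<close>
  have 1: "((\<lambda>s. (s - t) * (G' \<bullet> Y s)) has_real_derivative G' \<bullet> Y t) (at t)"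
    unfolding CARAT_DERIV using c by (intro exI[of _ "\<lambda>s. G' \<bullet> Y s"]) simp
  have "((\<lambda>s. norm (r s) / norm (s - t)) \<longlongrightarrow> 0) (at t)"
    using G unfolding has_vector_derivative_def has_derivative_iff_norm r_def by simp
  moreover have "((\<lambda>s. norm (Y s)) \<longlongrightarrow> norm (Y t)) (at t)" using Y by (simp add: isCont_def)
  ultimately have "((\<lambda>s. norm (r s) / norm (s - t) * norm (Y s)) \<longlongrightarrow> 0 * norm (Y t)) (at t)"
    by (rule tendsto_mult)
  then have lim: "((\<lambda>s. norm (r s) / norm (s - t) * norm (Y s)) \<longlongrightarrow> 0) (at t)" by simp
  have "norm ((r s \<bullet> Y s) / (s - t)) \<le> norm (r s) / norm (s - t) * norm (Y s)" for s
    using divide_right_mono[OF Cauchy_Schwarz_ineq2[of "r s" "Y s"] abs_ge_zero[of "s - t"]] by simp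
  then have "((\<lambda>s. (r s \<bullet> Y s) / (s - t)) \<longlongrightarrow> 0) (at t)"
    by (intro Lim_null_comparison[OF always_eventually lim] allI)
  then have 2: "((\<lambda>s. r s \<bullet> Y s) has_real_derivative 0) (at t)"
    by (simp add: has_field_derivative_iff r_def)
  have "G s \<bullet> Y s = (s - t) * (G' \<bullet> Y s) + G t \<bullet> Y s + r s \<bullet> Y s" for s
    by (simp add: r_def inner_diff_left)
  then have "(\<lambda>s. G s \<bullet> Y s) = (\<lambda>s. (s - t) * (G' \<bullet> Y s) + G t \<bullet> Y s + r s \<bullet> Y s)" by (rule ext)
  moreover have "((\<lambda>s. (s - t) * (G' \<bullet> Y s) + G t \<bullet> Y s + r s \<bullet> Y s) has_real_derivative
      G' \<bullet> Y t + d + 0) (at t)"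
    by (intro DERIV_add 1 d 2)
  ultimately show ?thesis by simp
qed

lemma has_integral_from_0_linear:
  assumes "has_integral_from_0 f I t" "bounded_linear T"
  shows "has_integral_from_0 (\<lambda>s. T (f s)) (T I) t"
proof (cases "0 \<le> t")
  case True
  with assms show ?thesis
    using has_integral_linear[of f I "{0..t}" T] by (simp add: has_integral_from_0_def o_def)
next
  case False
  with assms have "((\<lambda>s. T (f s)) has_integral T (- I)) {t..0}"
    using has_integral_linear[of f "- I" "{t..0}" T] by (simp add: has_integral_from_0_def o_def)
  then show ?thesis
    using False linear_neg[OF bounded_linear.linear[OF assms(2)], of I] by (simp add: has_integral_from_0_def)
qed

lemma has_integral_from_0_derivative:
  fixes f :: "real \<Rightarrow> real"
  assumes f: "continuous_on UNIV f" and I: "\<And>t. has_integral_from_0 f (I t) t"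
  shows "(I has_real_derivative f t) (at t)"
proof -
  \<comment> \<open>The margin 1 puts 0 and t strictly inside [-a, a]; the integral can then start
    at -a for either sign of t and be differentiated at an interior point.\<close>
  define a where "a = \<bar>t\<bar> + 1"
  define J where "J x = integral {-a..x} f" for x
  have int: "f integrable_on {x..y}" for x y
    by (rule integrable_continuous_real) (rule continuous_on_subset[OF f], simp)
  have I_eq: "I x = J x - J 0" if "x \<in> {-a<..<a}" for x
  proof (cases "0 \<le> x")
    case True
    then have "I x = integral {0..x} f" using I[of x] by (simp add: has_integral_from_0_def integral_unique)
    moreover have "J 0 + integral {0..x} f = J x"
      unfolding J_def using True that by (intro Henstock_Kurzweil_Integration.integral_combine int) (auto simp: a_def)
    ultimately show ?thesis by simp
  next
    case False
    then have "- I x = integral {x..0} f" using I[of x] by (simp add: has_integral_from_0_def integral_unique)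
    moreover have "J x + integral {x..0} f = J 0"
      unfolding J_def using False that by (intro Henstock_Kurzweil_Integration.integral_combine int) auto
    ultimately show ?thesis by simp
  qed
  have t: "t \<in> {-a<..<a}" unfolding a_def by (simp; linarith)
  have "(J has_real_derivative f t) (at t within {-a..a})"
    unfolding J_def using t by (intro integral_has_real_derivative continuous_on_subset[OF f]) auto
  then have "(J has_real_derivative f t) (at t)"
    using t by (subst (asm) at_within_interior) simp_all
  from DERIV_diff[OF this DERIV_const[of "J 0"]]
  have "((\<lambda>x. J x - J 0) has_real_derivative f t) (at t)" by simp
  then show ?thesis
    by (rule has_field_derivative_transform_within_open[OF _ open_greaterThanLessThan t]) (simp only: I_eq)
qed

lemma mild_solution_weak_derivative:
  fixes X F :: "real \<Rightarrow> transversal_field \<times> transversal_field"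
  assumes X: "continuous_on UNIV X" and F: "continuous_on UNIV F"
    and mild: "\<And>t. has_integral_from_0 (\<lambda>s. free_evolution (t - s) (F s)) (X t - free_evolution t (X 0)) t"
    and f: "moments_L2 f" and g: "moments_L2 g"
  shows "((\<lambda>s. (abs_transversal_field f, abs_transversal_field g) \<bullet> X s) has_real_derivative
     (- abs_transversal_field (\<lambda>k. norm k *\<^sub>R g k), abs_transversal_field (\<lambda>k. norm k *\<^sub>R f k)) \<bullet> X t
     + (abs_transversal_field f, abs_transversal_field g) \<bullet> F t) (at t)"
proof -
  define Y where "Y s = free_evolution (- s) (X s)" for s
  \<comment> \<open>The test vector is frozen at time r while \<open>Y\<close> moves. With r = t
    this gives the derivative for \<open>?W\<close>, and for \<open>?V\<close> the continuity that
    \<open>weak_product_rule\<close> asks for.\<close>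
  have der_Y: "((\<lambda>s. free_evolution (- r) W \<bullet> Y s) has_real_derivative free_evolution (t - r) W \<bullet> F t) (at t)"
    if "continuous_on UNIV (\<lambda>s. free_evolution s W)" for W r t
  proof -
    have cont: "continuous_on UNIV (\<lambda>s. free_evolution (s - r) W \<bullet> F s)"
      by (intro continuous_intros F continuous_on_compose2[OF that]) auto
    have "has_integral_from_0 (\<lambda>s. free_evolution (s - r) W \<bullet> F s)
       (free_evolution (- r) W \<bullet> Y u - free_evolution (- r) W \<bullet> X 0) u" for u
    proof -
      \<comment> \<open>Applying R_{-u} and pairing turns the integrand of the mild equation into a
        scalar function free of the upper limit u, so the fundamental theorem of calculus
        applies.\<close>
      let ?T = "\<lambda>Z. free_evolution (- r) W \<bullet> free_evolution (- u) Z"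
      have "bounded_linear ?T"
        by (rule bounded_linear_compose[OF bounded_linear_inner_right bounded_linear_free_evolution])
      from has_integral_from_0_linear[OF mild[of u] this] show ?thesis
        by (simp add: free_evolution_add linear_diff[OF bounded_linear.linear[OF bounded_linear_free_evolution]]
            inner_diff_right Y_def free_evolution_0 inner_free_evolution[of _ "- _"])
    qed
    from has_integral_from_0_derivative[OF cont this, of t]
    have "((\<lambda>u. free_evolution (- r) W \<bullet> Y u - free_evolution (- r) W \<bullet> X 0)
        has_real_derivative free_evolution (t - r) W \<bullet> F t) (at t)" .
    from DERIV_add[OF this DERIV_const[of "free_evolution (- r) W \<bullet> X 0"]]
    show ?thesis by simp
  qed
  let ?W = "(abs_transversal_field f, abs_transversal_field g)"
  \<comment> \<open>\<open>?V\<close> is minus the generator of the flow applied to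
    \<open>?W\<close>, the sign coming from differentiating R_{-s}.\<close>
  let ?V = "(- abs_transversal_field (\<lambda>k. norm k *\<^sub>R g k), abs_transversal_field (\<lambda>k. norm k *\<^sub>R f k))"
  have cont: "continuous_on UNIV (\<lambda>s. free_evolution s (abs_transversal_field f', abs_transversal_field g'))"
    if "moments_L2 f'" "moments_L2 g'" for f' g'
    using has_vector_derivative_free_evolution[OF that]
    by (meson continuous_at_imp_continuous_on has_vector_derivative_continuous)
  have V: "?V = (abs_transversal_field (\<lambda>k. - (norm k *\<^sub>R g k)), abs_transversal_field (\<lambda>k. norm k *\<^sub>R f k))"
    using moments_L2_imp_L2[OF moments_L2_norm_mult[OF g]] by (simp add: abs_field_simps)
  have contV: "continuous_on UNIV (\<lambda>s. free_evolution s ?V)"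
    unfolding V by (intro cont moments_L2_uminus moments_L2_norm_mult f g)
  have "((\<lambda>s. free_evolution (- s) ?W \<bullet> Y s) has_real_derivative
     free_evolution (- t) ?V \<bullet> Y t + free_evolution (t - t) ?W \<bullet> F t) (at t)"
  proof (rule weak_product_rule)
    have "((\<lambda>s. free_evolution (- s) ?W) has_vector_derivative
      (-1) *\<^sub>R free_evolution (- t) (abs_transversal_field (\<lambda>k. norm k *\<^sub>R g k), - abs_transversal_field (\<lambda>k. norm k *\<^sub>R f k))) (at t)"
      using vector_diff_chain_at[OF _ has_vector_derivative_free_evolution[OF f g], of uminus "-1" t]
      by (simp add: o_def has_vector_derivative_minus[OF has_vector_derivative_id])
    also have "(-1) *\<^sub>R free_evolution (- t) (abs_transversal_field (\<lambda>k. norm k *\<^sub>R g k), - abs_transversal_field (\<lambda>k. norm k *\<^sub>R f k))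
      = free_evolution (- t) ((-1) *\<^sub>R (abs_transversal_field (\<lambda>k. norm k *\<^sub>R g k), - abs_transversal_field (\<lambda>k. norm k *\<^sub>R f k)))"
      by (rule linear_scale[OF bounded_linear.linear[OF bounded_linear_free_evolution], symmetric])
    finally show "((\<lambda>s. free_evolution (- s) ?W) has_vector_derivative free_evolution (- t) ?V) (at t)"
      by simp
    show "isCont (\<lambda>s. norm (Y s)) t"
      unfolding Y_def norm_free_evolution using X by (simp add: continuous_on_eq_continuous_at)
    show "((\<lambda>s. free_evolution (- t) ?W \<bullet> Y s) has_real_derivative free_evolution (t - t) ?W \<bullet> F t) (at t)"
      by (rule der_Y[OF cont[OF f g]])
    show "isCont (\<lambda>s. free_evolution (- t) ?V \<bullet> Y s) t"
      by (rule DERIV_isCont[OF der_Y[OF contV]])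
  qed
  then show ?thesis
    by (simp add: Y_def inner_free_evolution free_evolution_add free_evolution_0)
qed

section \<open>The fields and their sources\<close>

text \<open>The common factor of \<open>a_vec\<close> and \<open>b_vec\<close>, which differ only by
  sin (k . x) and cos (k . x).\<close>

definition amplitude :: "(real \<Rightarrow> real) \<Rightarrow> 3 \<Rightarrow> real^3 \<Rightarrow> real^3" where
  "amplitude chi m k =
     (chi (norm k) * sqrt (norm k) / (2 * pi) powr (3/2)) *\<^sub>R ((1 / norm k) *\<^sub>R cross3 k (axis m 1))"

lemma a_vec_eq: "a_vec chi x m = abs_transversal_field (\<lambda>k. sin (k \<bullet> x) *\<^sub>R amplitude chi m k)"
  unfolding a_vec_def amplitude_def by (simp add: mult.commute)

lemma b_vec_eq: "b_vec chi x m = abs_transversal_field (\<lambda>k. cos (k \<bullet> x) *\<^sub>R amplitude chi m k)"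
  unfolding b_vec_def amplitude_def by (simp add: mult.commute)

text \<open>The normalised cross product has length at most 1, and the square of |k|^(n + 1/2)
  \<chi>(|k|) is the integrand of a moment of \<chi>^2 of order 2 n + 1.\<close>

lemma moments_L2_amplitude:
  assumes "schwartz chi"
  shows "moments_L2 (amplitude chi m)"
  unfolding moments_L2_def transversal_L2_def
proof (intro allI conjI)
  fix n j
  have chi: "continuous_on UNIV (\<lambda>k::real^3. chi (norm k))"
    by (intro continuous_on_compose2[OF schwartz_continuous[OF assms]] continuous_intros) auto
  have [measurable]: "(\<lambda>k::real^3. chi (norm k)) \<in> borel_measurable borel"
    "(\<lambda>k::real^3. cross3 k (axis m 1) $ j) \<in> borel_measurable borel"
    by (intro borel_measurable_continuous_onI chi continuous_on_component continuous_on_cross continuous_intros)+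
  show meas: "(\<lambda>k. (norm k ^ n *\<^sub>R amplitude chi m k) $ j) \<in> borel_measurable lborel"
    unfolding amplitude_def vector_scaleR_component by measurable
  show "integrable lborel (\<lambda>k. ((norm k ^ n *\<^sub>R amplitude chi m k) $ j)\<^sup>2)"
  proof (rule Bochner_Integration.integrable_bound)
    let ?c = "1 / ((2 * pi) powr (3/2))\<^sup>2"
    show "integrable lborel (\<lambda>k::real^3. ?c * (norm k ^ (2 * n + 1) * (chi (norm k))\<^sup>2))"
      by (intro integrable_mult_right integrable_chi_moment assms)
    show "(\<lambda>k. ((norm k ^ n *\<^sub>R amplitude chi m k) $ j)\<^sup>2) \<in> borel_measurable lborel"
      using meas by measurable
    show "AE k in lborel. norm (((norm k ^ n *\<^sub>R amplitude chi m k) $ j)\<^sup>2)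
        \<le> norm (?c * (norm k ^ (2 * n + 1) * (chi (norm k))\<^sup>2))"
    proof (intro always_eventually allI)
      fix k :: "real^3"
      have "(norm (cross3 k (axis m 1)))\<^sup>2 \<le> (norm k * norm (axis m 1 :: real^3))\<^sup>2"
        using norm_cross_dot[of k "axis m 1"] zero_le_power2[of "k \<bullet> axis m 1"] by linarith
      then have "norm (cross3 k (axis m 1)) \<le> norm k * norm (axis m 1 :: real^3)"
        by (rule power2_le_imp_le) simp
      then have "\<bar>cross3 k (axis m 1) $ j\<bar> \<le> norm k"
        using component_le_norm_cart[of "cross3 k (axis m 1)" j] by simp
      then have "\<bar>(1 / norm k) * cross3 k (axis m 1) $ j\<bar> \<le> 1"
        by (cases "k = 0") (simp_all add: abs_mult divide_le_eq)
      then have u: "((1 / norm k) * cross3 k (axis m 1) $ j)\<^sup>2 \<le> 1"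
        by (simp add: abs_square_le_1)
      have sq: "(sqrt (norm k))\<^sup>2 = norm k" by simp
      have "((norm k ^ n *\<^sub>R amplitude chi m k) $ j)\<^sup>2
          = ?c * (norm k ^ (2 * n) * (sqrt (norm k))\<^sup>2 * (chi (norm k))\<^sup>2) * ((1 / norm k) * cross3 k (axis m 1) $ j)\<^sup>2"
        unfolding amplitude_def vector_scaleR_component
        by (simp only: power_mult_distrib power_divide power_mult mult.commute[of 2 n]) (simp add: field_simps)
      also have "\<dots> \<le> ?c * (norm k ^ (2 * n) * (sqrt (norm k))\<^sup>2 * (chi (norm k))\<^sup>2) * 1"
        by (intro mult_left_mono u) simp
      also have "\<dots> = ?c * (norm k ^ (2 * n + 1) * (chi (norm k))\<^sup>2)"
        unfolding sq by simp
      finally have "((norm k ^ n *\<^sub>R amplitude chi m k) $ j)\<^sup>2 \<le> ?c * (norm k ^ (2 * n + 1) * (chi (norm k))\<^sup>2)" .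
      then show "norm (((norm k ^ n *\<^sub>R amplitude chi m k) $ j)\<^sup>2)
          \<le> norm (?c * (norm k ^ (2 * n + 1) * (chi (norm k))\<^sup>2))"
        unfolding real_norm_def abs_power2 by (rule order_trans[OF _ abs_ge_self])
    qed
  qed
next
  fix n
  show "AE k in lborel. k \<bullet> (norm k ^ n *\<^sub>R amplitude chi m k) = 0"
    by (simp add: amplitude_def dot_cross_self)
qed

lemma moments_L2_mult:
  assumes f: "moments_L2 f" and s: "s \<in> borel_measurable lborel" "\<And>k. \<bar>s k\<bar> \<le> 1"
  shows "moments_L2 (\<lambda>k. s k *\<^sub>R f k)"
  unfolding moments_L2_def
proof
  fix n
  have "transversal_L2 (\<lambda>k. s k *\<^sub>R (norm k ^ n *\<^sub>R f k))"
    using f by (intro transversal_L2_mult[OF _ s]) (auto simp: moments_L2_def)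
  then show "transversal_L2 (\<lambda>k. norm k ^ n *\<^sub>R s k *\<^sub>R f k)"
    by (simp add: mult.commute)
qed

lemma moments_L2_waves:
  assumes "moments_L2 f"
  shows "moments_L2 (\<lambda>k. sin (k \<bullet> x) *\<^sub>R f k)" "moments_L2 (\<lambda>k. cos (k \<bullet> x) *\<^sub>R f k)"
  by (rule moments_L2_mult[OF assms]; simp)+

lemma amplitude_inner:
  "amplitude chi m k \<bullet> w
     = chi (norm k) * sqrt (norm k) / (2 * pi) powr (3/2) / norm k * (cross3 k (axis m 1) \<bullet> w)"
  by (simp add: amplitude_def)

text \<open>\<open>(M a\<^sub>m) \<cdot> p - (M b\<^sub>m) \<cdot> q\<close>\<close>

definition B_flux ::
  "(real \<Rightarrow> real) \<Rightarrow> 3 \<Rightarrow> real^3 \<Rightarrow> transversal_field \<times> transversal_field \<Rightarrow> real" where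
  "B_flux chi m x Z =
     (- abs_transversal_field (\<lambda>k. norm k *\<^sub>R cos (k \<bullet> x) *\<^sub>R amplitude chi m k),
      abs_transversal_field (\<lambda>k. norm k *\<^sub>R sin (k \<bullet> x) *\<^sub>R amplitude chi m k)) \<bullet> Z"

lemma B_form_eq_inner: "B_form chi m x Z = (a_vec chi x m, b_vec chi x m) \<bullet> Z"
  by (cases Z) (simp add: B_form_def)

text \<open>Stated for any mild solution with continuous source F, because it is also applied to -J
  X with source -J F.\<close>

lemma B_form_mild_derivative:
  assumes chi: "schwartz chi"
    and X: "continuous_on UNIV X" and F: "continuous_on UNIV F"
    and mild: "\<And>t. has_integral_from_0 (\<lambda>s. free_evolution (t - s) (F s)) (X t - free_evolution t (X 0)) t"
  shows "((\<lambda>s. B_form chi m x (X s)) has_real_derivative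
     B_flux chi m x (X t) + B_form chi m x (F t)) (at t)"
  unfolding B_form_eq_inner a_vec_eq b_vec_eq B_flux_def
  by (rule mild_solution_weak_derivative[OF X F mild]) (intro moments_L2_waves moments_L2_amplitude chi)+

section \<open>Divergence and curl of the forms\<close>

context
  fixes chi :: "real \<Rightarrow> real" and q p :: "real^3 \<Rightarrow> real^3"
  assumes chi: "schwartz chi" and q: "transversal_L2 q" and p: "transversal_L2 p"
begin

lemma integrable_amplitude_moment:
  assumes "transversal_L2 f"
  shows "integrable lborel (\<lambda>k. norm k ^ n * (amplitude chi m k \<bullet> f k))"
  using integrable_inner_L2[OF _ assms, of "\<lambda>k. norm k ^ n *\<^sub>R amplitude chi m k"]
    moments_L2_amplitude[OF chi, of m] by (simp add: moments_L2_def)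

lemma B_form_abs_field:
  "B_form chi m x (abs_transversal_field q, abs_transversal_field p)
     = (\<integral>k. sin (k \<bullet> x) * (amplitude chi m k \<bullet> q k) + cos (k \<bullet> x) * (amplitude chi m k \<bullet> p k) \<partial>lborel)"
proof -
  note L = moments_L2_imp_L2[OF moments_L2_waves(1)[OF moments_L2_amplitude[OF chi]]]
    moments_L2_imp_L2[OF moments_L2_waves(2)[OF moments_L2_amplitude[OF chi]]]
  show ?thesis
    unfolding B_form_def a_vec_eq b_vec_eq fst_conv snd_conv inner_abs_field[OF L(1) q] inner_abs_field[OF L(2) p]
    by (subst Bochner_Integration.integral_add[OF integrable_inner_L2[OF L(1) q] integrable_inner_L2[OF L(2) p], symmetric])
      simp
qed

lemma has_derivative_B_form:
  "((\<lambda>y. B_form chi m y (abs_transversal_field q, abs_transversal_field p)) has_derivative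
     (\<lambda>v. \<integral>k. (k \<bullet> v) * (cos (k \<bullet> x) * (amplitude chi m k \<bullet> q k) - sin (k \<bullet> x) * (amplitude chi m k \<bullet> p k)) \<partial>lborel)) (at x)"
  unfolding B_form_abs_field
  by (intro has_derivative_oscillatory_integral integrable_amplitude_moment q p)

lemma partial_deriv_B_form:
  "partial_deriv j (\<lambda>y. B_form chi m y (abs_transversal_field q, abs_transversal_field p)) x
     = (\<integral>k. k $ j * (amplitude chi m k \<bullet> (cos (k \<bullet> x) *\<^sub>R q k - sin (k \<bullet> x) *\<^sub>R p k)) \<partial>lborel)"
  unfolding partial_deriv_eq[OF has_derivative_B_form]
  by (simp add: inner_axis inner_diff_right)

lemma integrable_partial_B_form:
  "integrable lborel (\<lambda>k. k $ j * (amplitude chi m k \<bullet> (cos (k \<bullet> x) *\<^sub>R q k - sin (k \<bullet> x) *\<^sub>R p k)))"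
  using integrable_oscillatory_derivative[OF integrable_amplitude_moment[OF q] integrable_amplitude_moment[OF p],
      of "axis j 1" x m m]
  by (simp add: inner_axis inner_diff_right)

lemma div_B_form_abs_field:
  "div_field (\<lambda>y. \<chi> m. B_form chi m y (abs_transversal_field q, abs_transversal_field p)) x = 0"
proof -
  \<comment> \<open>The sum over j of k_j (k \<times> e_j) is k \<times> k = 0.\<close>
  have z: "(\<Sum>j\<in>UNIV. k $ j * (amplitude chi j k \<bullet> w)) = 0" for k w :: "real^3"
  proof -
    have "(\<Sum>j\<in>UNIV. k $ j * (cross3 k (axis j 1) \<bullet> w)) = 0"
      by (simp add: cross3_simps axis_def)
    then show ?thesis
      unfolding amplitude_inner mult.left_commute[of "k $ _"] sum_distrib_left[symmetric]
      by (simp only: mult_zero_right)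
  qed
  show ?thesis
    by (simp add: div_field_def partial_deriv_B_form z integrable_partial_B_form
        flip: Bochner_Integration.integral_sum)
qed

text \<open>On plane waves the curl acts as k \<times>. The numbers (k \<times> e_m) . w are the
  components of w \<times> k, and k \<times> (w \<times> k) has the components (k \<times> e_m) . (k
  \<times> w). So the curl amounts to applying the helicity to w and multiplying by |k|, which is
  the flux of J up to sign.\<close>

lemma rot_B_form_abs_field:
  "rot (\<lambda>y. \<chi> m. B_form chi m y (abs_transversal_field q, abs_transversal_field p)) x
     = (\<chi> m. - B_flux chi m x (J_map (abs_transversal_field q, abs_transversal_field p)))"
proof -
  \<comment> \<open>The derivative of sin (k . x) q + cos (k . x) p along v is (k . v) w(k).\<close>
  define w where "w k = cos (k \<bullet> x) *\<^sub>R q k - sin (k \<bullet> x) *\<^sub>R p k" for k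
  define A where "A = amplitude chi"
  have flux: "- B_flux chi m x (J_map (abs_transversal_field q, abs_transversal_field p))
     = (\<integral>k. norm k * (A m k \<bullet> ((1 / norm k) *\<^sub>R cross3 k (w k))) \<partial>lborel)" for m
  proof -
    note L = moments_L2_imp_L2[OF moments_L2_norm_mult[OF moments_L2_waves(1)[OF moments_L2_amplitude[OF chi, of m]]]]
      moments_L2_imp_L2[OF moments_L2_norm_mult[OF moments_L2_waves(2)[OF moments_L2_amplitude[OF chi, of m]]]]
    note I = integrable_inner_L2[OF L(1) transversal_L2_cross[OF p], of x]
      integrable_inner_L2[OF L(2) transversal_L2_cross[OF q], of x]
    have "- B_flux chi m x (J_map (abs_transversal_field q, abs_transversal_field p))
      = (\<integral>k. (norm k *\<^sub>R cos (k \<bullet> x) *\<^sub>R A m k) \<bullet> ((1 / norm k) *\<^sub>R cross3 k (q k)) \<partial>lborel)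
        - (\<integral>k. (norm k *\<^sub>R sin (k \<bullet> x) *\<^sub>R A m k) \<bullet> ((1 / norm k) *\<^sub>R cross3 k (p k)) \<partial>lborel)"
      unfolding B_flux_def J_map_def fst_conv snd_conv abs_field_simps(3)[OF q] abs_field_simps(3)[OF p] inner_Pair
        inner_minus_left inner_abs_field[OF L(1) transversal_L2_cross[OF p]] inner_abs_field[OF L(2) transversal_L2_cross[OF q]]
        A_def by simp
    also have "\<dots> = (\<integral>k. (norm k *\<^sub>R cos (k \<bullet> x) *\<^sub>R A m k) \<bullet> ((1 / norm k) *\<^sub>R cross3 k (q k))
        - (norm k *\<^sub>R sin (k \<bullet> x) *\<^sub>R A m k) \<bullet> ((1 / norm k) *\<^sub>R cross3 k (p k)) \<partial>lborel)"
      unfolding A_def by (rule Bochner_Integration.integral_diff[OF I(2) I(1), symmetric])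
    also have "\<dots> = (\<integral>k. norm k * (A m k \<bullet> ((1 / norm k) *\<^sub>R cross3 k (w k))) \<partial>lborel)"
    proof (rule Bochner_Integration.integral_cong[OF refl])
      fix k
      have "cross3 k (w k) = cos (k \<bullet> x) *\<^sub>R cross3 k (q k) - sin (k \<bullet> x) *\<^sub>R cross3 k (p k)"
        by (simp add: w_def cross_mult_right left_diff_distrib cross_add_right diff_conv_add_uminus
            del: add_uminus_conv_diff)
      then show "(norm k *\<^sub>R cos (k \<bullet> x) *\<^sub>R A m k) \<bullet> ((1 / norm k) *\<^sub>R cross3 k (q k))
        - (norm k *\<^sub>R sin (k \<bullet> x) *\<^sub>R A m k) \<bullet> ((1 / norm k) *\<^sub>R cross3 k (p k))
        = norm k * (A m k \<bullet> ((1 / norm k) *\<^sub>R cross3 k (w k)))"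
        by (simp add: inner_diff_right right_diff_distrib)
    qed
    finally show ?thesis .
  qed
  have pd: "partial_deriv i (\<lambda>y. B_form chi m y (abs_transversal_field q, abs_transversal_field p)) x
     - partial_deriv j (\<lambda>y. B_form chi l y (abs_transversal_field q, abs_transversal_field p)) x
     = (\<integral>k. k $ i * (A m k \<bullet> w k) - k $ j * (A l k \<bullet> w k) \<partial>lborel)" for i j m l
    unfolding partial_deriv_B_form w_def A_def
    by (intro Bochner_Integration.integral_diff[symmetric] integrable_partial_B_form)
  have ptw: "k $ 2 * (A 3 k \<bullet> u) - k $ 3 * (A 2 k \<bullet> u) = norm k * (A 1 k \<bullet> ((1 / norm k) *\<^sub>R cross3 k u))"
    "k $ 3 * (A 1 k \<bullet> u) - k $ 1 * (A 3 k \<bullet> u) = norm k * (A 2 k \<bullet> ((1 / norm k) *\<^sub>R cross3 k u))"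
    "k $ 1 * (A 2 k \<bullet> u) - k $ 2 * (A 1 k \<bullet> u) = norm k * (A 3 k \<bullet> ((1 / norm k) *\<^sub>R cross3 k u))" for k u
  proof -
    let ?c = "chi (norm k) * sqrt (norm k) / (2 * pi) powr (3/2) / norm k"
    have n: "norm k * (A m k \<bullet> ((1 / norm k) *\<^sub>R cross3 k u)) = ?c * (cross3 k (axis m 1) \<bullet> cross3 k u)" for m
      by (cases "k = 0") (simp_all add: A_def amplitude_inner)
    have v: "k $ 2 * (cross3 k (axis 3 1) \<bullet> u) - k $ 3 * (cross3 k (axis 2 1) \<bullet> u) = cross3 k (axis 1 1) \<bullet> cross3 k u"
      "k $ 3 * (cross3 k (axis 1 1) \<bullet> u) - k $ 1 * (cross3 k (axis 3 1) \<bullet> u) = cross3 k (axis 2 1) \<bullet> cross3 k u"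
      "k $ 1 * (cross3 k (axis 2 1) \<bullet> u) - k $ 2 * (cross3 k (axis 1 1) \<bullet> u) = cross3 k (axis 3 1) \<bullet> cross3 k u"
      by (simp_all add: cross3_simps axis_def)
    show "k $ 2 * (A 3 k \<bullet> u) - k $ 3 * (A 2 k \<bullet> u) = norm k * (A 1 k \<bullet> ((1 / norm k) *\<^sub>R cross3 k u))"
      "k $ 3 * (A 1 k \<bullet> u) - k $ 1 * (A 3 k \<bullet> u) = norm k * (A 2 k \<bullet> ((1 / norm k) *\<^sub>R cross3 k u))"
      "k $ 1 * (A 2 k \<bullet> u) - k $ 2 * (A 1 k \<bullet> u) = norm k * (A 3 k \<bullet> ((1 / norm k) *\<^sub>R cross3 k u))"
      unfolding n v[symmetric] by (simp_all only: A_def amplitude_inner right_diff_distrib mult.left_commute)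
  qed
  show ?thesis
    unfolding vec_eq_iff forall_3 rot_def vector_3 vec_lambda_beta pd flux ptw by simp
qed

end

lemma linear_B_form: "linear (B_form chi m x)"
  by (rule linearI) (simp_all add: B_form_eq_inner inner_add_right)

lemma bounded_linear_B_form: "bounded_linear (B_form chi m x)"
  unfolding B_form_eq_inner by (rule bounded_linear_inner_right)

lemma B_flux_uminus: "B_flux chi m x (- Z) = - B_flux chi m x Z"
  unfolding B_flux_def by (rule inner_minus_right)

lemma field_pair_cases:
  obtains q p where "transversal_L2 q" "transversal_L2 p"
    "Z = (abs_transversal_field q, abs_transversal_field p)"
  by (metis transversal_field_cases prod.collapse)

lemma div_B_form: "schwartz chi \<Longrightarrow> div_field (\<lambda>y. \<chi> m. B_form chi m y Z) x = 0"
  by (rule field_pair_cases[of Z]) (simp add: div_B_form_abs_field)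

lemma rot_B_form: "schwartz chi \<Longrightarrow> rot (\<lambda>y. \<chi> m. B_form chi m y Z) x = (\<chi> m. - B_flux chi m x (J_map Z))"
  by (rule field_pair_cases[of Z]) (simp add: rot_B_form_abs_field)

lemma differentiable_vec:
  fixes f :: "'a::euclidean_space \<Rightarrow> real ^ 'n"
  assumes "\<And>i. (\<lambda>y. f y $ i) differentiable (at x)"
  shows "f differentiable (at x)"
proof -
  obtain f' where f': "\<And>i. ((\<lambda>y. f y $ i) has_derivative f' i) (at x)"
    using assms unfolding differentiable_def by metis
  have "linear (\<lambda>v. \<chi> i. f' i v)"
    by (rule linearI)
      (simp_all add: vec_eq_iff linear_add[OF has_derivative_linear[OF f']] linear_scale[OF has_derivative_linear[OF f']])
  then have "(f has_derivative (\<lambda>v. \<chi> i. f' i v)) (at x)"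
    using f' unfolding has_derivative_within
    by (auto intro!: vec_tendstoI simp: linear_conv_bounded_linear)
  then show ?thesis by (rule differentiableI)
qed

lemma B_form_differentiable:
  assumes "schwartz chi"
  shows "(\<lambda>y. \<chi> m. B_form chi m y Z) differentiable (at x)"
proof (rule differentiable_vec)
  fix m
  obtain q p where "transversal_L2 q" "transversal_L2 p"
    and Z: "Z = (abs_transversal_field q, abs_transversal_field p)" by (rule field_pair_cases)
  then show "(\<lambda>y. (\<chi> m. B_form chi m y Z) $ m) differentiable (at x)"
    unfolding Z vec_lambda_beta by (intro differentiableI[OF has_derivative_B_form] assms)
qed

text \<open>k \<times> (k \<times> f) = (k . f) k - |k|^2 f, and transversality removes the first
  term. Both k . f(k) = 0 and the division by |k| are available almost everywhere, which is enough
  in H.\<close>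

lemma helicity_helicity: "helicity (helicity q) = - q"
proof -
  obtain f where f: "transversal_L2 f" "q = abs_transversal_field f" by (rule transversal_field_cases)
  have "AE k in lborel. k \<noteq> (0 :: real^3)"
    by (rule AE_lborel_singleton)
  moreover have "AE k in lborel. k \<bullet> f k = 0" using f(1) by (simp add: transversal_L2_def)
  ultimately have "AE k in lborel. (1 / norm k) *\<^sub>R cross3 k ((1 / norm k) *\<^sub>R cross3 k (f k)) = - f k"
  proof eventually_elim
    fix k assume k: "k \<noteq> 0" "k \<bullet> f k = 0"
    have "cross3 k (cross3 k (f k)) = (k \<bullet> f k) *\<^sub>R k - (k \<bullet> k) *\<^sub>R f k"
      by (simp add: cross3_simps forall_3)
    also have "\<dots> = - ((norm k)\<^sup>2 *\<^sub>R f k)" using k by (simp add: power2_norm_eq_inner)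
    finally show "(1 / norm k) *\<^sub>R cross3 k ((1 / norm k) *\<^sub>R cross3 k (f k)) = - f k"
      using k(1) by (simp add: cross_mult_right power2_eq_square)
  qed
  then show ?thesis
    unfolding f(2) by (simp add: abs_field_simps transversal_L2_intros f(1))
      (rule abs_field_eqI; use f(1) transversal_L2_cross in \<open>simp add: transversal_L2_intros\<close>)
qed

lemma J_map_J_map: "J_map (J_map Z) = - Z"
  by (cases Z) (simp add: J_map_def helicity_helicity)

section \<open>The density \<open>rho\<close> and the source terms\<close>

lemma rho_has_derivative:
  assumes "schwartz chi"
  shows "(rho chi has_derivative
    (\<lambda>v. 1 / (2 * pi) ^ 3 * (\<integral>k. (k \<bullet> v) * (- (sin (k \<bullet> x) * (chi (norm k))\<^sup>2)) \<partial>lborel))) (at x)"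
  unfolding rho_def
  using has_derivative_mult_right[OF has_derivative_oscillatory_integral[of "\<lambda>_. 0", OF _ integrable_chi_moment[OF assms]],
      of "1 / (2 * pi) ^ 3" x]
  by (simp add: mult.commute)

lemma grad_rho:
  assumes "schwartz chi"
  shows "grad (rho chi) x $ j = - (1 / (2 * pi) ^ 3) * (\<integral>k. k $ j * (sin (k \<bullet> x) * (chi (norm k))\<^sup>2) \<partial>lborel)"
  unfolding grad_def vec_lambda_beta partial_deriv_eq[OF rho_has_derivative[OF assms]]
  by (simp add: inner_axis)

lemma integrable_grad_rho:
  assumes "schwartz chi"
  shows "integrable lborel (\<lambda>k::real^3. k $ j * (sin (k \<bullet> x) * (chi (norm k))\<^sup>2))"
  using integrable_oscillatory_derivative[of "\<lambda>_. 0" "\<lambda>k. (chi (norm k))\<^sup>2" "axis j 1 :: real^3" x]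
    integrable_chi_moment[OF assms]
  by (simp add: inner_axis)

lemma amplitude_uminus: "amplitude chi m (- k) = - amplitude chi m k"
  by (simp add: amplitude_def)

text \<open>Lebesgue measure is invariant under k \<mapsto> -k. A non-measurable function has
  Bochner integral 0 by default, which settles the remaining case.\<close>

lemma integral_odd:
  fixes f :: "'a::euclidean_space \<Rightarrow> real"
  assumes "\<And>k. f (- k) = - f k"
  shows "integral\<^sup>L lborel f = 0"
proof (cases "f \<in> borel_measurable borel")
  case True
  have "lborel = distr lborel borel (uminus :: 'a \<Rightarrow> 'a)"
    using lborel_affine[of "-1" "0 :: 'a"] by (simp add: density_1)
  then have "integral\<^sup>L lborel f = integral\<^sup>L (distr lborel borel uminus) f"
    by (rule arg_cong)
  also have "\<dots> = (\<integral>k. f (- k) \<partial>lborel)"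
    using True by (intro integral_distr) auto
  finally have "integral\<^sup>L lborel f = (\<integral>k. f (- k) \<partial>lborel)" .
  then show ?thesis by (simp add: assms)
qed (auto intro!: not_integrable_integral_eq dest: borel_measurable_integrable)

text \<open>The integrand of the difference is sin (k . (x - y)) times the product of two
  amplitudes, both odd in k; it is therefore odd.\<close>

lemma a_b_symmetric:
  assumes "schwartz chi"
  shows "a_vec chi x m \<bullet> b_vec chi y l = b_vec chi x m \<bullet> a_vec chi y l"
proof -
  note A = moments_L2_amplitude[OF assms]
  note L = moments_L2_imp_L2[OF moments_L2_waves(1)[OF A]] moments_L2_imp_L2[OF moments_L2_waves(2)[OF A]]
  have "a_vec chi x m \<bullet> b_vec chi y l - b_vec chi x m \<bullet> a_vec chi y l
    = (\<integral>k. (sin (k \<bullet> x) *\<^sub>R amplitude chi m k) \<bullet> (cos (k \<bullet> y) *\<^sub>R amplitude chi l k)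
       - (cos (k \<bullet> x) *\<^sub>R amplitude chi m k) \<bullet> (sin (k \<bullet> y) *\<^sub>R amplitude chi l k) \<partial>lborel)"
    unfolding a_vec_eq b_vec_eq inner_abs_field[OF L] inner_abs_field[OF L(2) L(1)]
    by (rule Bochner_Integration.integral_diff[symmetric]) (intro integrable_inner_L2 L)+
  also have "\<dots> = 0"
    by (rule integral_odd) (simp add: amplitude_uminus)
  finally show ?thesis by simp
qed

text \<open>All powers of |k| cancel: the two square roots give |k|, the three normalisations
  |k|^(-3), and the double cross product |k|^2. Only \<chi>^2, the integrand of \<open>rho\<close>,
  remains. At k = 0 both sides vanish.\<close>

lemma amplitude_cross_amplitude:
  "amplitude chi m k \<bullet> ((1 / norm k) *\<^sub>R cross3 k (amplitude chi l k))
     = (chi (norm k))\<^sup>2 / (2 * pi) ^ 3 * cross3 k (axis l 1) $ m"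
proof (cases "k = 0")
  case False
  define c where "c = chi (norm k) * sqrt (norm k) / (2 * pi) powr (3/2)"
  have p: "((2 * pi) powr (3/2))\<^sup>2 = (2 * pi) ^ 3"
  proof -
    have "((2 * pi) powr (3/2))\<^sup>2 = (2 * pi) powr (3/2 + 3/2)"
      by (simp only: power2_eq_square powr_add)
    also have "3/2 + 3/2 = (3::real)" by simp
    also have "(2 * pi) powr 3 = (2 * pi) ^ 3"
      by (rule powr_numeral) simp
    finally show ?thesis .
  qed
  have "cross3 k u \<bullet> cross3 k (cross3 k v) = (k \<bullet> k) * (u \<bullet> cross3 k v)" for u v
    by (simp add: cross3_simps)
  then have id: "cross3 k (axis m 1) \<bullet> cross3 k (cross3 k (axis l 1)) = (norm k)\<^sup>2 * cross3 k (axis l 1) $ m"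
    by (simp add: inner_axis inner_commute[of "axis m 1"] power2_norm_eq_inner)
  have "amplitude chi m k \<bullet> ((1 / norm k) *\<^sub>R cross3 k (amplitude chi l k))
      = c\<^sup>2 / norm k ^ 3 * (cross3 k (axis m 1) \<bullet> cross3 k (cross3 k (axis l 1)))"
    unfolding amplitude_def c_def[symmetric] by (simp add: cross_mult_right power2_eq_square power3_eq_cube)
  also have "\<dots> = c\<^sup>2 / norm k * cross3 k (axis l 1) $ m"
    unfolding id using False by (simp add: power2_eq_square power3_eq_cube)
  also have "c\<^sup>2 / norm k = (chi (norm k))\<^sup>2 / (2 * pi) ^ 3"
    using False unfolding c_def power_divide power_mult_distrib p by simp
  finally show ?thesis .
qed simp

text \<open>By the sine subtraction formula this is (2 \<pi>)^(-3) times the integral of \<chi>^2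
  sin (k . (x - y)) (k \<times> e_l). Reversing the cross product and differentiating the cosine in
  \<open>rho\<close> each give a minus sign, and the two cancel.\<close>

lemma a_b_helicity:
  assumes chi: "schwartz chi"
  shows "a_vec chi x m \<bullet> helicity (b_vec chi y l) - b_vec chi x m \<bullet> helicity (a_vec chi y l)
    = cross3 (axis l 1) (grad (rho chi) (x - y)) $ m"
proof -
  note A = moments_L2_amplitude[OF chi]
  note L = moments_L2_imp_L2[OF moments_L2_waves(1)[OF A]] moments_L2_imp_L2[OF moments_L2_waves(2)[OF A]]
  let ?\<phi> = "\<lambda>j k. k $ j * (sin (k \<bullet> (x - y)) * (chi (norm k))\<^sup>2)"
  have "a_vec chi x m \<bullet> helicity (b_vec chi y l) - b_vec chi x m \<bullet> helicity (a_vec chi y l)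
    = (\<integral>k. (sin (k \<bullet> x) *\<^sub>R amplitude chi m k) \<bullet> ((1 / norm k) *\<^sub>R cross3 k (cos (k \<bullet> y) *\<^sub>R amplitude chi l k))
       - (cos (k \<bullet> x) *\<^sub>R amplitude chi m k) \<bullet> ((1 / norm k) *\<^sub>R cross3 k (sin (k \<bullet> y) *\<^sub>R amplitude chi l k)) \<partial>lborel)"
    unfolding a_vec_eq b_vec_eq abs_field_simps(3)[OF L(1)] abs_field_simps(3)[OF L(2)]
      inner_abs_field[OF L(1) transversal_L2_cross[OF L(2)]] inner_abs_field[OF L(2) transversal_L2_cross[OF L(1)]]
    by (rule Bochner_Integration.integral_diff[symmetric]) (intro integrable_inner_L2 transversal_L2_cross L)+
  also have "\<dots> = (\<integral>k. - (1 / (2 * pi) ^ 3) * (sin (k \<bullet> (x - y)) * (chi (norm k))\<^sup>2 * cross3 (axis l 1) k $ m) \<partial>lborel)"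
  proof (rule Bochner_Integration.integral_cong[OF refl])
    fix k
    have "(sin (k \<bullet> x) *\<^sub>R amplitude chi m k) \<bullet> ((1 / norm k) *\<^sub>R cross3 k (cos (k \<bullet> y) *\<^sub>R amplitude chi l k))
       - (cos (k \<bullet> x) *\<^sub>R amplitude chi m k) \<bullet> ((1 / norm k) *\<^sub>R cross3 k (sin (k \<bullet> y) *\<^sub>R amplitude chi l k))
       = sin (k \<bullet> (x - y)) * (amplitude chi m k \<bullet> ((1 / norm k) *\<^sub>R cross3 k (amplitude chi l k)))"
      by (simp add: cross_mult_right inner_diff_right sin_diff left_diff_distrib right_diff_distrib diff_divide_distrib mult_ac)
    also have "\<dots> = - (1 / (2 * pi) ^ 3) * (sin (k \<bullet> (x - y)) * (chi (norm k))\<^sup>2 * cross3 (axis l 1) k $ m)"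
      unfolding amplitude_cross_amplitude cross_skew[of k "axis l 1"] by simp
    finally show "(sin (k \<bullet> x) *\<^sub>R amplitude chi m k) \<bullet> ((1 / norm k) *\<^sub>R cross3 k (cos (k \<bullet> y) *\<^sub>R amplitude chi l k))
       - (cos (k \<bullet> x) *\<^sub>R amplitude chi m k) \<bullet> ((1 / norm k) *\<^sub>R cross3 k (sin (k \<bullet> y) *\<^sub>R amplitude chi l k))
       = - (1 / (2 * pi) ^ 3) * (sin (k \<bullet> (x - y)) * (chi (norm k))\<^sup>2 * cross3 (axis l 1) k $ m)" .
  qed
  also have "\<dots> = - (1 / (2 * pi) ^ 3) * (\<integral>k. sin (k \<bullet> (x - y)) * (chi (norm k))\<^sup>2 * cross3 (axis l 1) k $ m \<partial>lborel)"
    by (rule integral_mult_right_zero)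
  also have "\<dots> = cross3 (axis l 1) (grad (rho chi) (x - y)) $ m"
  proof -
    have "(\<integral>k. sin (k \<bullet> (x - y)) * (chi (norm k))\<^sup>2 * cross3 v k $ m \<partial>lborel)
       = cross3 v (\<chi> j. \<integral>k. ?\<phi> j k \<partial>lborel) $ m" for v :: "real^3"
    proof -
      have *: "(\<integral>k. v $ i * ?\<phi> j k - ?\<phi> j' k * v $ i' \<partial>lborel)
         = v $ i * (\<integral>k. ?\<phi> j k \<partial>lborel) - (\<integral>k. ?\<phi> j' k \<partial>lborel) * v $ i'" for i j i' j'
        by (subst Bochner_Integration.integral_diff)
          (auto intro!: integrable_mult_right integrable_mult_left integrable_grad_rho chi
            simp del: mult_cancel_left mult_cancel_right)
      have "sin (k \<bullet> (x - y)) * (chi (norm k))\<^sup>2 * cross3 v k $ 1 = v $ 2 * ?\<phi> 3 k - ?\<phi> 2 k * v $ 3"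
        "sin (k \<bullet> (x - y)) * (chi (norm k))\<^sup>2 * cross3 v k $ 2 = v $ 3 * ?\<phi> 1 k - ?\<phi> 3 k * v $ 1"
        "sin (k \<bullet> (x - y)) * (chi (norm k))\<^sup>2 * cross3 v k $ 3 = v $ 1 * ?\<phi> 2 k - ?\<phi> 1 k * v $ 2" for k
        unfolding cross3_nth by (simp_all add: algebra_simps)
      then show ?thesis
        using exhaust_3[of m] by (elim disjE) (simp_all only: * cross3_nth vec_lambda_beta)
    qed
    moreover have "grad (rho chi) (x - y) = (- (1 / (2 * pi) ^ 3)) *\<^sub>R (\<chi> j. \<integral>k. ?\<phi> j k \<partial>lborel)"
      by (simp add: vec_eq_iff grad_rho[OF chi])
    ultimately show ?thesis
      by (simp only: cross_mult_right vector_scaleR_component real_scaleR_def)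
  qed
  finally show ?thesis .
qed

text \<open>Q combines the \<open>b_vec\<close> with the same coefficients with which -P combines
  the \<open>a_vec\<close>, so the two contributions cancel by symmetry. Hence no current appears in
  the equation for B.\<close>

lemma B_form_source:
  assumes "schwartz chi"
  shows "B_form chi m x (Q_source chi h xs w, P_source chi h xs w) = 0"
proof -
  have "a_vec chi x m \<bullet> Q_source chi h xs w = b_vec chi x m \<bullet> - P_source chi h xs w"
    by (simp add: Q_source_def P_source_def inner_sum_right a_b_symmetric[OF assms])
  then show ?thesis by (simp add: B_form_def)
qed

text \<open>The cross product is linear in its first factor, so the coefficients of \<omega> gather
  the basis vectors e_j into the spin vector at each site.\<close>

lemma B_form_J_source:
  assumes "schwartz chi"
  shows "B_form chi m x (J_map (Q_source chi h xs w, P_source chi h xs w))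
    = h * (\<Sum>l\<in>UNIV. cross3 (\<chi> j. blinfun_apply w (i_sigma l j)) (grad (rho chi) (x - xs l)) $ m)"
proof -
  let ?S = "\<lambda>l j. blinfun_apply w (i_sigma l j)"
  note lin = bounded_linear.linear[OF bounded_linear_helicity]
  have expand: "cross3 (\<chi> j. s j) g $ m = (\<Sum>j\<in>UNIV. s j * cross3 (axis j 1) g $ m)"
    for s :: "3 \<Rightarrow> real" and g :: "real^3"
  proof -
    have "\<forall>m. cross3 (\<chi> j. s j) g $ m = (\<Sum>j\<in>UNIV. s j * cross3 (axis j 1) g $ m)"
      by (simp add: forall_3 sum_3 cross3_nth axis_def)
    then show ?thesis by blast
  qed
  have "B_form chi m x (J_map (Q_source chi h xs w, P_source chi h xs w))
    = h * (\<Sum>l\<in>UNIV. \<Sum>j\<in>UNIV. ?S l j *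
        (a_vec chi x m \<bullet> helicity (b_vec chi (xs l) j) - b_vec chi x m \<bullet> helicity (a_vec chi (xs l) j)))"
    by (simp add: B_form_def J_map_def Q_source_def P_source_def linear_scale[OF lin] linear_neg[OF lin]
        linear_sum[OF lin] inner_sum_right right_diff_distrib sum_subtractf)
  then show ?thesis
    unfolding a_b_helicity[OF assms] expand[symmetric] .
qed

lemma E_form_eq_B_form: "E_form chi m x Z = B_form chi m x (- J_map Z)"
  by (simp add: E_form_def linear_neg[OF linear_B_form])

text \<open>Differentiability of B, E and \<open>rho\<close> in x is asserted along with the
  equations, since divergence, curl and gradient are built from \<open>deriv\<close> and carry
  information only where derivatives exist.\<close>

theorem mainTheorem4:
  fixes chi :: "real \<Rightarrow> real" and h :: real and \<beta> :: "real^3"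
    and xs :: "'n::finite \<Rightarrow> real^3"
    and X :: "real \<Rightarrow> transversal_field \<times> transversal_field"
    and \<omega> :: "real \<Rightarrow> 'n su_dual"
  assumes "schwartz chi" and "\<forall>\<^sub>F r in nhds 0. chi r = 0"
    and "h > 0"
    and "weak_solution chi h xs \<beta> X \<omega>"
    and "\<omega> 0 \<in> pure_states"
  shows "(\<forall>t. \<omega> t \<in> pure_states) \<and>
    (\<forall>x. rho chi differentiable (at x)) \<and>
    (\<forall>x t.
       (\<lambda>y. B_appr chi X y t) differentiable (at x) \<and>
       (\<lambda>y. E_appr chi X y t) differentiable (at x) \<and>
       div_field (\<lambda>y. B_appr chi X y t) x = 0 \<and>
       div_field (\<lambda>y. E_appr chi X y t) x = 0 \<and>
       ((\<lambda>s. B_appr chi X x s) has_vector_derivative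
          - rot (\<lambda>y. E_appr chi X y t) x) (at t) \<and>
       ((\<lambda>s. E_appr chi X x s) has_vector_derivative
          (rot (\<lambda>y. B_appr chi X y t) x
           - h *\<^sub>R (\<Sum>l\<in>UNIV. cross3 (S_appr \<omega> l t) (grad (rho chi) (x - xs l))))) (at t))"
proof -
  note chi = assms(1)
  define F where "F t = (Q_source chi h xs (\<omega> t), P_source chi h xs (\<omega> t))" for t
  have cont: "continuous_on UNIV (\<lambda>t. (X t, \<omega> t))"
    and mild: "\<And>t. has_integral_from_0 (\<lambda>s. free_evolution (t - s) (F s)) (X t - free_evolution t (X 0)) t"
    and spin: "\<And>Y t. has_integral_from_0
        (\<lambda>s. \<Sum>l\<in>UNIV. \<Sum>m\<in>UNIV. (\<beta> $ m + B_form chi m (xs l) (X s)) *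
                blinfun_apply (\<omega> s) (su_bracket (i_sigma l m) Y))
        (blinfun_apply (\<omega> t) Y - blinfun_apply (\<omega> 0) Y) t"
    using assms(4) by (auto simp: weak_solution_def F_def)
  have X: "continuous_on UNIV X" and \<omega>: "continuous_on UNIV \<omega>"
    using continuous_on_fst[OF cont] continuous_on_snd[OF cont] by simp_all
  have F: "continuous_on UNIV F"
    unfolding F_def Q_source_def P_source_def by (intro continuous_intros \<omega>)

  have pure: "\<omega> t \<in> pure_states" for t
  proof (rule pure_states_preserved[of \<omega>
        "\<lambda>t. \<Sum>l\<in>UNIV. \<Sum>m\<in>UNIV. (\<beta> $ m + B_form chi m (xs l) (X t)) *\<^sub>R i_sigma l m"])
    fix Y t
    let ?A = "\<Sum>l\<in>UNIV. \<Sum>m\<in>UNIV. (\<beta> $ m + B_form chi m (xs l) (X t)) *\<^sub>R (i_sigma l m :: 'n su)"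
    let ?f = "\<lambda>s. \<Sum>l\<in>UNIV. \<Sum>m\<in>UNIV. (\<beta> $ m + B_form chi m (xs l) (X s)) *
                blinfun_apply (\<omega> s) (su_bracket (i_sigma l m) Y)"
    have "continuous_on UNIV ?f"
      by (intro continuous_intros \<omega> bounded_linear.continuous_on[OF bounded_linear_B_form X])
    from DERIV_add[OF has_integral_from_0_derivative[OF this spin, of t] DERIV_const[of "blinfun_apply (\<omega> 0) Y"]]
    have "((\<lambda>s. blinfun_apply (\<omega> s) Y) has_real_derivative ?f t) (at t)" by simp
    moreover have "?f t = blinfun_apply (\<omega> t) (su_bracket ?A Y)"
    proof -
      \<comment> \<open>The bracket is linear in its first entry, so the weighted sum of brackets is
        a single bracket with the time-dependent element \<open>?A\<close>.\<close>
      have lin: "linear (\<lambda>A. su_bracket A Y)"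
        by (rule linearI; transfer)
          (simp_all add: matrix_add_ldistrib matrix_add_rdistrib matrix_scaleR_left matrix_scaleR_right scaleR_diff_right)
      show ?thesis
        by (simp add: linear_sum[OF lin] linear_scale[OF lin] blinfun.sum_right blinfun.scaleR_right)
    qed
    ultimately show "((\<lambda>s. blinfun_apply (\<omega> s) Y) has_real_derivative blinfun_apply (\<omega> t) (su_bracket ?A Y)) (at t)"
      by simp
  qed (rule assms(5))

  have B_appr: "B_appr chi X y t = (\<chi> m. B_form chi m y (X t))" for y t
    by (rule B_appr_def)
  have E_appr: "E_appr chi X y t = (\<chi> m. B_form chi m y (- J_map (X t)))" for y t
    by (simp add: E_appr_def E_form_eq_B_form)
  have lin: "bounded_linear (\<lambda>Z. - J_map Z)"
    by (rule bounded_linear_minus[OF bounded_linear_J_map])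
  note linJ = bounded_linear.linear[OF bounded_linear_J_map]
  note linR = bounded_linear.linear[OF bounded_linear_free_evolution]
  have J_mild: "has_integral_from_0 (\<lambda>s. free_evolution (t - s) (- J_map (F s)))
      (- J_map (X t) - free_evolution t (- J_map (X 0))) t" for t
    using has_integral_from_0_linear[OF mild[of t] lin]
    by (simp add: linear_diff[OF linJ] linear_neg[OF linR] J_map_free_evolution)
  have J_cont: "continuous_on UNIV (\<lambda>s. - J_map (X s))" "continuous_on UNIV (\<lambda>s. - J_map (F s))"
    by (rule bounded_linear.continuous_on[OF lin X], rule bounded_linear.continuous_on[OF lin F])

  have dB: "((\<lambda>s. B_appr chi X x s) has_vector_derivative - rot (\<lambda>y. E_appr chi X y t) x) (at t)" for x t
  proof (rule has_vector_derivative_vec)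
    fix m
    \<comment> \<open>E is \<open>B_form\<close> of -J X, so its curl is minus the flux of -J J X =
      X.\<close>
    have "(- rot (\<lambda>y. E_appr chi X y t) x) $ m = B_flux chi m x (X t)"
      unfolding E_appr rot_B_form[OF chi] by (simp add: linear_neg[OF linJ] J_map_J_map)
    then show "((\<lambda>s. B_appr chi X x s $ m) has_vector_derivative (- rot (\<lambda>y. E_appr chi X y t) x) $ m) (at t)"
      using B_form_mild_derivative[OF chi X F mild, of m x t]
      by (simp add: B_appr has_real_derivative_iff_has_vector_derivative F_def B_form_source[OF chi])
  qed
  have dE: "((\<lambda>s. E_appr chi X x s) has_vector_derivative
          (rot (\<lambda>y. B_appr chi X y t) x
           - h *\<^sub>R (\<Sum>l\<in>UNIV. cross3 (S_appr \<omega> l t) (grad (rho chi) (x - xs l))))) (at t)" for x t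
  proof (rule has_vector_derivative_vec)
    fix m
    \<comment> \<open>The flux of -J X is the curl of B, and the source -J F gives the spin current
      with its factor -h.\<close>
    have "B_flux chi m x (- J_map (X t)) + B_form chi m x (- J_map (F t))
      = (rot (\<lambda>y. B_appr chi X y t) x
           - h *\<^sub>R (\<Sum>l\<in>UNIV. cross3 (S_appr \<omega> l t) (grad (rho chi) (x - xs l)))) $ m"
      unfolding B_appr rot_B_form[OF chi] S_appr_def F_def linear_neg[OF linear_B_form] B_form_J_source[OF chi]
      by (simp add: B_flux_uminus)
    then show "((\<lambda>s. E_appr chi X x s $ m) has_vector_derivative
        (rot (\<lambda>y. B_appr chi X y t) x
           - h *\<^sub>R (\<Sum>l\<in>UNIV. cross3 (S_appr \<omega> l t) (grad (rho chi) (x - xs l)))) $ m) (at t)"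
      using B_form_mild_derivative[OF chi J_cont J_mild, of m x t]
      by (simp add: E_appr has_real_derivative_iff_has_vector_derivative)
  qed
  show ?thesis
    using pure dB dE differentiableI[OF rho_has_derivative[OF chi]]
    by (auto simp: B_appr E_appr div_B_form[OF chi] B_form_differentiable[OF chi])
qed

end
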